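(* All of the following rules are admissible in $\mathrm{WE}\text{-}\mathrm{HA}^\omega+(\mathrm{LOOP}_D)$: (i) $\{P\}\,\mathtt{skip}\,\{P\}$; (ii) from $P(s,\gamma s t)\to Q(cs,t)\in\mathrm{Ax}$ infer $\{P\}\,\langle c,\gamma\rangle\,\{Q\}$; (iii) from $P'\to P$, $\{P\}\,C\,\{Q\}$ and $Q\to Q'$ infer $\{P'\}\,C\,\{Q'\}$; (iv) from $\{P\}\,C_1\,\{Q\}$ and $\{Q\}\,C_2\,\{R\}$ infer $\{P\}\,C_1;C_2\,\{R\}$; (v) from $\{P\wedge\phi\}\,C_1\,\{R\}$ and $\{Q\wedge\neg\phi\}\,C_2\,\{R\}$ infer $\{P\vee_\phi Q\}\,\mathtt{if}\ \phi\ \mathtt{then}\ C_1\ \mathtt{else}\ C_2\,\{R\}$; (vi) from $\{P\wedge\phi\}\,C\,\{P\}$ and $\phi(s)\to C^+s\prec s$ infer $\{P\}\,\mathtt{while}_\prec\ \phi\ \mathtt{do}\ C\,\{P\wedge\neg\phi\}$.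
   Context: $\mathrm{WE}\text{-}\mathrm{HA}^\omega$ is weakly extensional higher-order Heyting arithmetic (terms: System T). It is extended with two abstract state types $S,T$ with decidable equalities; a set $\mathtt{Comm}^+$ of forward primitive commands $c:S\to S$; a set $\mathtt{Comm}^-$ of backward primitive commands $\gamma:S\to T\to T$; a set $\mathtt{Exp}$ of decidable predicates $\phi$ on $S$; a set $\mathtt{Rel}$ of decidable wellfounded relations $\prec$ on $S$; a set $\mathcal{U}$ of purely universal axioms (including the set $\mathrm{Ax}$ governing primitive commands). Commands are $C::=\mathtt{skip}\mid\langle c,\gamma\rangle\mid C;C\mid \mathtt{if}\ \phi\ \mathtt{then}\ C\ \mathtt{else}\ C\mid \mathtt{while}_\prec\ \phi\ \mathtt{do}\ C$, with axiom $C=\langle C^+,C^-\rangle$, where $C^+:S\to S$, $C^-:S\to T\to T$ are defined by: $\mathtt{skip}^+=\lambda s.s$, $\mathtt{skip}^-=\lambda s,t.t$; $\langle c,\gamma\rangle^+=c$, $\langle c,\gamma\rangle^-=\gamma$; $(C_1;C_2)^+=C_2^+\circ C_1^+$, $(C_1;C_2)^-=\lambda s,t.C_1^-s(C_2^-(C_1^+s)t)$; conditional: $\lambda s.\,\mathtt{if}\ \phi(s)\ \mathtt{then}\ C_1^+s\ \mathtt{else}\ C_2^+s$ and $\lambda s,t.\,\mathtt{if}\ \phi(s)\ \mathtt{then}\ C_1^-st\ \mathtt{else}\ C_2^-st$; while loop: $(\mathtt{while}_\prec\ \phi\ \mathtt{do}\ C)^+=W(\lambda s.s)(\lambda s,y.y)$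 and $(\mathtt{while}_\prec\ \phi\ \mathtt{do}\ C)^-=W(\lambda s,t.t)(\lambda s,f,t.C^-s(ft))$, where $W=\mathtt{whilerec}^\prec_{\phi,C^+}$ is a while recursor satisfying the axiom $(\phi(x)\to C^+x\prec x)\to W u F x = \mathtt{if}\ \phi(x)\ \mathtt{then}\ F x (W u F (C^+x))\ \mathtt{else}\ u x$. $\mathrm{WE}\text{-}\mathrm{HA}^\omega+(\mathrm{LOOP}_D)$ denotes this whole extension, including the while recursors and the wellfounded induction rule (from $\forall x(\forall y\prec x\, A(y)\to A(x))$ infer $\forall x\, A(x)$) for each $\prec\in\mathtt{Rel}$. For quantifier-free $P(s,t),Q(s,t)$ whose only free variables of type $S,T$ are $s,t$, the triple $\{P\}\,C\,\{Q\}$ abbreviates $\forall s,t\,(P(s,C^-st)\to Q(C^+s,t))$ (the Dialectica interpretation of $\exists s\forall t\,P(s,t)\to\exists s\forall t\,Q(s,t)$ realised by $C^+,C^-$). $P\wedge\phi$ abbreviates $P(s,t)\wedge\phi(s)$, and $P\vee_\phi Q$ abbreviates $(\phi(s)\to P(s,t))\wedge(\neg\phi(s)\to Q(s,t))$. *)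

theory Defs
  imports Main
begin

section \<open>Types, commands and terms\<close>

datatype ty =
    TyN
  | TyS
  | TyT
  | Fun ty ty  (infixr "\<rightarrow>" 65)
  | Prod ty ty  (infixr "\<otimes>" 70)

text \<open>
  The symbol sets of the extension are sets of names, drawn from the types 'c (forward
  primitive commands), 'g (backward primitive commands), 'e (predicates on the forward state)
  and 'r (relations on the forward state).
\<close>

datatype ('c, 'g, 'e, 'r) com =
    Skip
  | Prim 'c 'g
  | Seq "('c, 'g, 'e, 'r) com" "('c, 'g, 'e, 'r) com"
  | If 'e "('c, 'g, 'e, 'r) com" "('c, 'g, 'e, 'r) com"
  | While 'r 'e "('c, 'g, 'e, 'r) com"

text \<open>
  Locally nameless syntax: free variables carry a name and a type, bound variables are de
  Bruijn indices, shared between the lambda of terms and the quantifiers of formulas.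
  \<open>WhileRec r e d \<rho>\<close> is a constant indexed by the closed term \<open>d\<close> (the forward part of the
  loop body), so no operation on variables descends into \<open>d\<close>.
\<close>

datatype ('c, 'g, 'e, 'r) tm =
    Free nat ty
  | Bd nat
  | App "('c, 'g, 'e, 'r) tm" "('c, 'g, 'e, 'r) tm"  (infixl "\<cdot>" 100)
  | Lam ty "('c, 'g, 'e, 'r) tm"
  | Zero
  | Succ
  | Rec ty
  | Pair ty ty
  | Fst ty ty
  | Snd ty ty
  | Cond 'e ty
  | CmdF 'c
  | CmdB 'g
  | Cmd "('c, 'g, 'e, 'r) com"
  | WhileRec 'r 'e "('c, 'g, 'e, 'r) tm" ty

primrec fwd :: "('c, 'g, 'e, 'r) com \<Rightarrow> ('c, 'g, 'e, 'r) tm" where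
  "fwd Skip = Lam TyS (Bd 0)"
| "fwd (Prim c g) = CmdF c"
| "fwd (Seq C1 C2) = Lam TyS (fwd C2 \<cdot> (fwd C1 \<cdot> Bd 0))"
| "fwd (If e C1 C2) = Lam TyS (Cond e TyS \<cdot> Bd 0 \<cdot> (fwd C1 \<cdot> Bd 0) \<cdot> (fwd C2 \<cdot> Bd 0))"
| "fwd (While r e C) =
     WhileRec r e (fwd C) TyS \<cdot> Lam TyS (Bd 0) \<cdot> Lam TyS (Lam TyS (Bd 0))"

primrec bwd :: "('c, 'g, 'e, 'r) com \<Rightarrow> ('c, 'g, 'e, 'r) tm" where
  "bwd Skip = Lam TyS (Lam TyT (Bd 0))"
| "bwd (Prim c g) = CmdB g"
| "bwd (Seq C1 C2) =
     Lam TyS (Lam TyT (bwd C1 \<cdot> Bd 1 \<cdot> (bwd C2 \<cdot> (fwd C1 \<cdot> Bd 1) \<cdot> Bd 0)))"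
| "bwd (If e C1 C2) =
     Lam TyS (Lam TyT (Cond e TyT \<cdot> Bd 1 \<cdot> (bwd C1 \<cdot> Bd 1 \<cdot> Bd 0) \<cdot> (bwd C2 \<cdot> Bd 1 \<cdot> Bd 0)))"
| "bwd (While r e C) =
     WhileRec r e (fwd C) (TyT \<rightarrow> TyT)
       \<cdot> Lam TyS (Lam TyT (Bd 0))
       \<cdot> Lam TyS (Lam (TyT \<rightarrow> TyT) (Lam TyT (bwd C \<cdot> Bd 2 \<cdot> (Bd 1 \<cdot> Bd 0))))"

primrec fv :: "('c, 'g, 'e, 'r) tm \<Rightarrow> (nat \<times> ty) set" where
  "fv (Free x \<rho>) = {(x, \<rho>)}"
| "fv (Bd i) = {}"
| "fv (a \<cdot> b) = fv a \<union> fv b"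
| "fv (Lam \<rho> a) = fv a"
| "fv Zero = {}"
| "fv Succ = {}"
| "fv (Rec \<rho>) = {}"
| "fv (Pair \<rho> \<sigma>) = {}"
| "fv (Fst \<rho> \<sigma>) = {}"
| "fv (Snd \<rho> \<sigma>) = {}"
| "fv (Cond e \<rho>) = {}"
| "fv (CmdF c) = {}"
| "fv (CmdB g) = {}"
| "fv (Cmd C) = {}"
| "fv (WhileRec r e d \<rho>) = {}"

text \<open>Substitution for a free variable (capture-free, as only locally closed terms are
  substituted).\<close>

primrec subst :: "nat \<Rightarrow> ty \<Rightarrow> ('c, 'g, 'e, 'r) tm \<Rightarrow> ('c, 'g, 'e, 'r) tm \<Rightarrow> ('c, 'g, 'e, 'r) tm" where
  "subst x \<tau> u (Free y \<rho>) = (if y = x \<and> \<rho> = \<tau> then u else Free y \<rho>)"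
| "subst x \<tau> u (Bd i) = Bd i"
| "subst x \<tau> u (a \<cdot> b) = subst x \<tau> u a \<cdot> subst x \<tau> u b"
| "subst x \<tau> u (Lam \<rho> a) = Lam \<rho> (subst x \<tau> u a)"
| "subst x \<tau> u Zero = Zero"
| "subst x \<tau> u Succ = Succ"
| "subst x \<tau> u (Rec \<rho>) = Rec \<rho>"
| "subst x \<tau> u (Pair \<rho> \<sigma>) = Pair \<rho> \<sigma>"
| "subst x \<tau> u (Fst \<rho> \<sigma>) = Fst \<rho> \<sigma>"
| "subst x \<tau> u (Snd \<rho> \<sigma>) = Snd \<rho> \<sigma>"
| "subst x \<tau> u (Cond e \<rho>) = Cond e \<rho>"
| "subst x \<tau> u (CmdF c) = CmdF c"
| "subst x \<tau> u (CmdB g) = CmdB g"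
| "subst x \<tau> u (Cmd C) = Cmd C"
| "subst x \<tau> u (WhileRec r e d \<rho>) = WhileRec r e d \<rho>"

text \<open>\<open>inst k u\<close> replaces the bound index \<open>k\<close> by the locally closed term \<open>u\<close>; \<open>bind k x \<tau>\<close>
  is its inverse, turning a free variable into the index \<open>k\<close>.\<close>

primrec inst :: "nat \<Rightarrow> ('c, 'g, 'e, 'r) tm \<Rightarrow> ('c, 'g, 'e, 'r) tm \<Rightarrow> ('c, 'g, 'e, 'r) tm" where
  "inst k u (Free y \<rho>) = Free y \<rho>"
| "inst k u (Bd i) = (if i = k then u else Bd i)"
| "inst k u (a \<cdot> b) = inst k u a \<cdot> inst k u b"
| "inst k u (Lam \<rho> a) = Lam \<rho> (inst (Suc k) u a)"
| "inst k u Zero = Zero"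
| "inst k u Succ = Succ"
| "inst k u (Rec \<rho>) = Rec \<rho>"
| "inst k u (Pair \<rho> \<sigma>) = Pair \<rho> \<sigma>"
| "inst k u (Fst \<rho> \<sigma>) = Fst \<rho> \<sigma>"
| "inst k u (Snd \<rho> \<sigma>) = Snd \<rho> \<sigma>"
| "inst k u (Cond e \<rho>) = Cond e \<rho>"
| "inst k u (CmdF c) = CmdF c"
| "inst k u (CmdB g) = CmdB g"
| "inst k u (Cmd C) = Cmd C"
| "inst k u (WhileRec r e d \<rho>) = WhileRec r e d \<rho>"

primrec bind :: "nat \<Rightarrow> nat \<Rightarrow> ty \<Rightarrow> ('c, 'g, 'e, 'r) tm \<Rightarrow> ('c, 'g, 'e, 'r) tm" where
  "bind k x \<tau> (Free y \<rho>) = (if y = x \<and> \<rho> = \<tau> then Bd k else Free y \<rho>)"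
| "bind k x \<tau> (Bd i) = Bd i"
| "bind k x \<tau> (a \<cdot> b) = bind k x \<tau> a \<cdot> bind k x \<tau> b"
| "bind k x \<tau> (Lam \<rho> a) = Lam \<rho> (bind (Suc k) x \<tau> a)"
| "bind k x \<tau> Zero = Zero"
| "bind k x \<tau> Succ = Succ"
| "bind k x \<tau> (Rec \<rho>) = Rec \<rho>"
| "bind k x \<tau> (Pair \<rho> \<sigma>) = Pair \<rho> \<sigma>"
| "bind k x \<tau> (Fst \<rho> \<sigma>) = Fst \<rho> \<sigma>"
| "bind k x \<tau> (Snd \<rho> \<sigma>) = Snd \<rho> \<sigma>"
| "bind k x \<tau> (Cond e \<rho>) = Cond e \<rho>"
| "bind k x \<tau> (CmdF c) = CmdF c"
| "bind k x \<tau> (CmdB g) = CmdB g"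
| "bind k x \<tau> (Cmd C) = Cmd C"
| "bind k x \<tau> (WhileRec r e d \<rho>) = WhileRec r e d \<rho>"

text \<open>\<open>lift k\<close> increments the dangling indices \<open>\<ge> k\<close>.\<close>

primrec lift :: "nat \<Rightarrow> ('c, 'g, 'e, 'r) tm \<Rightarrow> ('c, 'g, 'e, 'r) tm" where
  "lift k (Free y \<rho>) = Free y \<rho>"
| "lift k (Bd i) = Bd (if i < k then i else Suc i)"
| "lift k (a \<cdot> b) = lift k a \<cdot> lift k b"
| "lift k (Lam \<rho> a) = Lam \<rho> (lift (Suc k) a)"
| "lift k Zero = Zero"
| "lift k Succ = Succ"
| "lift k (Rec \<rho>) = Rec \<rho>"
| "lift k (Pair \<rho> \<sigma>) = Pair \<rho> \<sigma>"
| "lift k (Fst \<rho> \<sigma>) = Fst \<rho> \<sigma>"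
| "lift k (Snd \<rho> \<sigma>) = Snd \<rho> \<sigma>"
| "lift k (Cond e \<rho>) = Cond e \<rho>"
| "lift k (CmdF c) = CmdF c"
| "lift k (CmdB g) = CmdB g"
| "lift k (Cmd C) = Cmd C"
| "lift k (WhileRec r e d \<rho>) = WhileRec r e d \<rho>"


section \<open>Formulas\<close>

text \<open>\<open>Eq b\<close> is primitive equality at the base type \<open>b\<close> (N, S or T); \<open>Test e\<close> and \<open>Below r\<close>
  are the atomic predicates given by a predicate symbol and a relation symbol.\<close>

datatype ('c, 'g, 'e, 'r) fm =
    Bot
  | Eq ty "('c, 'g, 'e, 'r) tm" "('c, 'g, 'e, 'r) tm"
  | Test 'e "('c, 'g, 'e, 'r) tm"
  | Below 'r "('c, 'g, 'e, 'r) tm" "('c, 'g, 'e, 'r) tm"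
  | And "('c, 'g, 'e, 'r) fm" "('c, 'g, 'e, 'r) fm"
  | Or "('c, 'g, 'e, 'r) fm" "('c, 'g, 'e, 'r) fm"
  | Imp "('c, 'g, 'e, 'r) fm" "('c, 'g, 'e, 'r) fm"
  | All ty "('c, 'g, 'e, 'r) fm"
  | Ex ty "('c, 'g, 'e, 'r) fm"

abbreviation Neg :: "('c, 'g, 'e, 'r) fm \<Rightarrow> ('c, 'g, 'e, 'r) fm" where
  "Neg A \<equiv> Imp A Bot"

primrec fvF :: "('c, 'g, 'e, 'r) fm \<Rightarrow> (nat \<times> ty) set" where
  "fvF Bot = {}"
| "fvF (Eq b p q) = fv p \<union> fv q"
| "fvF (Test e p) = fv p"
| "fvF (Below r p q) = fv p \<union> fv q"
| "fvF (And A B) = fvF A \<union> fvF B"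
| "fvF (Or A B) = fvF A \<union> fvF B"
| "fvF (Imp A B) = fvF A \<union> fvF B"
| "fvF (All \<rho> A) = fvF A"
| "fvF (Ex \<rho> A) = fvF A"

primrec substF :: "nat \<Rightarrow> ty \<Rightarrow> ('c, 'g, 'e, 'r) tm \<Rightarrow> ('c, 'g, 'e, 'r) fm \<Rightarrow> ('c, 'g, 'e, 'r) fm" where
  "substF x \<tau> u Bot = Bot"
| "substF x \<tau> u (Eq b p q) = Eq b (subst x \<tau> u p) (subst x \<tau> u q)"
| "substF x \<tau> u (Test e p) = Test e (subst x \<tau> u p)"
| "substF x \<tau> u (Below r p q) = Below r (subst x \<tau> u p) (subst x \<tau> u q)"
| "substF x \<tau> u (And A B) = And (substF x \<tau> u A) (substF x \<tau> u B)"
| "substF x \<tau> u (Or A B) = Or (substF x \<tau> u A) (substF x \<tau> u B)"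
| "substF x \<tau> u (Imp A B) = Imp (substF x \<tau> u A) (substF x \<tau> u B)"
| "substF x \<tau> u (All \<rho> A) = All \<rho> (substF x \<tau> u A)"
| "substF x \<tau> u (Ex \<rho> A) = Ex \<rho> (substF x \<tau> u A)"

primrec instF :: "nat \<Rightarrow> ('c, 'g, 'e, 'r) tm \<Rightarrow> ('c, 'g, 'e, 'r) fm \<Rightarrow> ('c, 'g, 'e, 'r) fm" where
  "instF k u Bot = Bot"
| "instF k u (Eq b p q) = Eq b (inst k u p) (inst k u q)"
| "instF k u (Test e p) = Test e (inst k u p)"
| "instF k u (Below r p q) = Below r (inst k u p) (inst k u q)"
| "instF k u (And A B) = And (instF k u A) (instF k u B)"
| "instF k u (Or A B) = Or (instF k u A) (instF k u B)"
| "instF k u (Imp A B) = Imp (instF k u A) (instF k u B)"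
| "instF k u (All \<rho> A) = All \<rho> (instF (Suc k) u A)"
| "instF k u (Ex \<rho> A) = Ex \<rho> (instF (Suc k) u A)"

primrec bindF :: "nat \<Rightarrow> nat \<Rightarrow> ty \<Rightarrow> ('c, 'g, 'e, 'r) fm \<Rightarrow> ('c, 'g, 'e, 'r) fm" where
  "bindF k x \<tau> Bot = Bot"
| "bindF k x \<tau> (Eq b p q) = Eq b (bind k x \<tau> p) (bind k x \<tau> q)"
| "bindF k x \<tau> (Test e p) = Test e (bind k x \<tau> p)"
| "bindF k x \<tau> (Below r p q) = Below r (bind k x \<tau> p) (bind k x \<tau> q)"
| "bindF k x \<tau> (And A B) = And (bindF k x \<tau> A) (bindF k x \<tau> B)"
| "bindF k x \<tau> (Or A B) = Or (bindF k x \<tau> A) (bindF k x \<tau> B)"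
| "bindF k x \<tau> (Imp A B) = Imp (bindF k x \<tau> A) (bindF k x \<tau> B)"
| "bindF k x \<tau> (All \<rho> A) = All \<rho> (bindF (Suc k) x \<tau> A)"
| "bindF k x \<tau> (Ex \<rho> A) = Ex \<rho> (bindF (Suc k) x \<tau> A)"

definition all_var :: "nat \<Rightarrow> ty \<Rightarrow> ('c, 'g, 'e, 'r) fm \<Rightarrow> ('c, 'g, 'e, 'r) fm" where
  "all_var x \<tau> A = All \<tau> (bindF 0 x \<tau> A)"

definition ex_var :: "nat \<Rightarrow> ty \<Rightarrow> ('c, 'g, 'e, 'r) fm \<Rightarrow> ('c, 'g, 'e, 'r) fm" where
  "ex_var x \<tau> A = Ex \<tau> (bindF 0 x \<tau> A)"

primrec qf :: "('c, 'g, 'e, 'r) fm \<Rightarrow> bool" where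
  "qf Bot = True"
| "qf (Eq b p q) = True"
| "qf (Test e p) = True"
| "qf (Below r p q) = True"
| "qf (And A B) = (qf A \<and> qf B)"
| "qf (Or A B) = (qf A \<and> qf B)"
| "qf (Imp A B) = (qf A \<and> qf B)"
| "qf (All \<rho> A) = False"
| "qf (Ex \<rho> A) = False"

fun purely_universal :: "('c, 'g, 'e, 'r) fm \<Rightarrow> bool" where
  "purely_universal (All \<rho> A) = purely_universal A"
| "purely_universal A = qf A"

text \<open>Equality at arbitrary types, extensionally reduced to equality at base types: pointwise
  at function types, componentwise at product types.\<close>

fun eq_ext :: "ty \<Rightarrow> ('c, 'g, 'e, 'r) tm \<Rightarrow> ('c, 'g, 'e, 'r) tm \<Rightarrow> ('c, 'g, 'e, 'r) fm" where
  "eq_ext TyN p q = Eq TyN p q"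
| "eq_ext TyS p q = Eq TyS p q"
| "eq_ext TyT p q = Eq TyT p q"
| "eq_ext (\<rho> \<rightarrow> \<sigma>) p q = All \<rho> (eq_ext \<sigma> (lift 0 p \<cdot> Bd 0) (lift 0 q \<cdot> Bd 0))"
| "eq_ext (\<rho> \<otimes> \<sigma>) p q =
     And (eq_ext \<rho> (Fst \<rho> \<sigma> \<cdot> p) (Fst \<rho> \<sigma> \<cdot> q)) (eq_ext \<sigma> (Snd \<rho> \<sigma> \<cdot> p) (Snd \<rho> \<sigma> \<cdot> q))"


section \<open>The parameters of the extension; well-formedness\<close>

record ('c, 'g, 'e, 'r) extn =
  CommF :: "'c set"
  CommB :: "'g set"
  Exps :: "'e set"
  Rels :: "'r set"
  Univ :: "('c, 'g, 'e, 'r) fm set"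
  Ax :: "('c, 'g, 'e, 'r) fm set"

primrec wf_com :: "('c, 'g, 'e, 'r) extn \<Rightarrow> ('c, 'g, 'e, 'r) com \<Rightarrow> bool" where
  "wf_com L Skip = True"
| "wf_com L (Prim c g) = (c \<in> CommF L \<and> g \<in> CommB L)"
| "wf_com L (Seq C1 C2) = (wf_com L C1 \<and> wf_com L C2)"
| "wf_com L (If e C1 C2) = (e \<in> Exps L \<and> wf_com L C1 \<and> wf_com L C2)"
| "wf_com L (While r e C) = (r \<in> Rels L \<and> e \<in> Exps L \<and> wf_com L C)"

text \<open>The list \<open>\<Gamma>\<close> gives the types of the dangling indices.\<close>

inductive typed ::
  "('c, 'g, 'e, 'r) extn \<Rightarrow> ty list \<Rightarrow> ('c, 'g, 'e, 'r) tm \<Rightarrow> ty \<Rightarrow> bool"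
  for L :: "('c, 'g, 'e, 'r) extn" where
  Free: "typed L \<Gamma> (Free x \<rho>) \<rho>"
| Bd: "i < length \<Gamma> \<Longrightarrow> typed L \<Gamma> (Bd i) (\<Gamma> ! i)"
| App: "typed L \<Gamma> a (\<rho> \<rightarrow> \<sigma>) \<Longrightarrow> typed L \<Gamma> b \<rho> \<Longrightarrow> typed L \<Gamma> (a \<cdot> b) \<sigma>"
| Lam: "typed L (\<rho> # \<Gamma>) a \<sigma> \<Longrightarrow> typed L \<Gamma> (Lam \<rho> a) (\<rho> \<rightarrow> \<sigma>)"
| Zero: "typed L \<Gamma> Zero TyN"
| Succ: "typed L \<Gamma> Succ (TyN \<rightarrow> TyN)"
| Rec: "typed L \<Gamma> (Rec \<rho>) (\<rho> \<rightarrow> (TyN \<rightarrow> \<rho> \<rightarrow> \<rho>) \<rightarrow> TyN \<rightarrow> \<rho>)"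
| Pair: "typed L \<Gamma> (Pair \<rho> \<sigma>) (\<rho> \<rightarrow> \<sigma> \<rightarrow> \<rho> \<otimes> \<sigma>)"
| Fst: "typed L \<Gamma> (Fst \<rho> \<sigma>) (\<rho> \<otimes> \<sigma> \<rightarrow> \<rho>)"
| Snd: "typed L \<Gamma> (Snd \<rho> \<sigma>) (\<rho> \<otimes> \<sigma> \<rightarrow> \<sigma>)"
| Cond: "e \<in> Exps L \<Longrightarrow> typed L \<Gamma> (Cond e \<rho>) (TyS \<rightarrow> \<rho> \<rightarrow> \<rho> \<rightarrow> \<rho>)"
| CmdF: "c \<in> CommF L \<Longrightarrow> typed L \<Gamma> (CmdF c) (TyS \<rightarrow> TyS)"
| CmdB: "g \<in> CommB L \<Longrightarrow> typed L \<Gamma> (CmdB g) (TyS \<rightarrow> TyT \<rightarrow> TyT)"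
| Cmd: "wf_com L C \<Longrightarrow> typed L \<Gamma> (Cmd C) ((TyS \<rightarrow> TyS) \<otimes> (TyS \<rightarrow> TyT \<rightarrow> TyT))"
| WhileRec: "r \<in> Rels L \<Longrightarrow> e \<in> Exps L \<Longrightarrow> wf_com L C \<Longrightarrow>
    typed L \<Gamma> (WhileRec r e (fwd C) \<rho>) ((TyS \<rightarrow> \<rho>) \<rightarrow> (TyS \<rightarrow> \<rho> \<rightarrow> \<rho>) \<rightarrow> TyS \<rightarrow> \<rho>)"

primrec wff :: "('c, 'g, 'e, 'r) extn \<Rightarrow> ty list \<Rightarrow> ('c, 'g, 'e, 'r) fm \<Rightarrow> bool" where
  "wff L \<Gamma> Bot = True"
| "wff L \<Gamma> (Eq b p q) = (b \<in> {TyN, TyS, TyT} \<and> typed L \<Gamma> p b \<and> typed L \<Gamma> q b)"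
| "wff L \<Gamma> (Test e p) = (e \<in> Exps L \<and> typed L \<Gamma> p TyS)"
| "wff L \<Gamma> (Below r p q) = (r \<in> Rels L \<and> typed L \<Gamma> p TyS \<and> typed L \<Gamma> q TyS)"
| "wff L \<Gamma> (And A B) = (wff L \<Gamma> A \<and> wff L \<Gamma> B)"
| "wff L \<Gamma> (Or A B) = (wff L \<Gamma> A \<and> wff L \<Gamma> B)"
| "wff L \<Gamma> (Imp A B) = (wff L \<Gamma> A \<and> wff L \<Gamma> B)"
| "wff L \<Gamma> (All \<rho> A) = wff L (\<rho> # \<Gamma>) A"
| "wff L \<Gamma> (Ex \<rho> A) = wff L (\<rho> # \<Gamma>) A"

definition wf_extn :: "('c, 'g, 'e, 'r) extn \<Rightarrow> bool" where
  "wf_extn L \<longleftrightarrow> Ax L \<subseteq> Univ L \<and> (\<forall>A \<in> Univ L. wff L [] A \<and> purely_universal A)"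


section \<open>Provability\<close>

text \<open>
  A Hilbert-style calculus for intuitionistic many-sorted logic, with the axioms and rules of
  weakly extensional Heyting arithmetic in all finite types and those of the extension by
  states. There are no hypotheses on the left of the turnstile, so the extensionality rule
  \<open>QF_ER\<close> and the wellfounded induction rule \<open>WF_Ind\<close> apply to theorems only.
\<close>

inductive provable :: "('c, 'g, 'e, 'r) extn \<Rightarrow> ('c, 'g, 'e, 'r) fm \<Rightarrow> bool"  (infix "\<turnstile>" 50)
  for L :: "('c, 'g, 'e, 'r) extn" where

  \<comment> \<open>intuitionistic predicate logic\<close>
  MP: "L \<turnstile> Imp A B \<Longrightarrow> L \<turnstile> A \<Longrightarrow> L \<turnstile> B"
| Imp_K: "wff L [] A \<Longrightarrow> wff L [] B \<Longrightarrow> L \<turnstile> Imp A (Imp B A)"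
| Imp_S: "wff L [] A \<Longrightarrow> wff L [] B \<Longrightarrow> wff L [] C \<Longrightarrow>
    L \<turnstile> Imp (Imp A (Imp B C)) (Imp (Imp A B) (Imp A C))"
| And_I: "wff L [] A \<Longrightarrow> wff L [] B \<Longrightarrow> L \<turnstile> Imp A (Imp B (And A B))"
| And_E1: "wff L [] A \<Longrightarrow> wff L [] B \<Longrightarrow> L \<turnstile> Imp (And A B) A"
| And_E2: "wff L [] A \<Longrightarrow> wff L [] B \<Longrightarrow> L \<turnstile> Imp (And A B) B"
| Or_I1: "wff L [] A \<Longrightarrow> wff L [] B \<Longrightarrow> L \<turnstile> Imp A (Or A B)"
| Or_I2: "wff L [] A \<Longrightarrow> wff L [] B \<Longrightarrow> L \<turnstile> Imp B (Or A B)"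
| Or_E: "wff L [] A \<Longrightarrow> wff L [] B \<Longrightarrow> wff L [] C \<Longrightarrow>
    L \<turnstile> Imp (Imp A C) (Imp (Imp B C) (Imp (Or A B) C))"
| Bot_E: "wff L [] A \<Longrightarrow> L \<turnstile> Imp Bot A"
| All_E: "wff L [] (All \<rho> A) \<Longrightarrow> typed L [] u \<rho> \<Longrightarrow> L \<turnstile> Imp (All \<rho> A) (instF 0 u A)"
| Ex_I: "wff L [] (Ex \<rho> A) \<Longrightarrow> typed L [] u \<rho> \<Longrightarrow> L \<turnstile> Imp (instF 0 u A) (Ex \<rho> A)"
| All_I: "L \<turnstile> Imp A B \<Longrightarrow> (x, \<rho>) \<notin> fvF A \<Longrightarrow> L \<turnstile> Imp A (all_var x \<rho> B)"
| Ex_E: "L \<turnstile> Imp B A \<Longrightarrow> (x, \<rho>) \<notin> fvF A \<Longrightarrow> L \<turnstile> Imp (ex_var x \<rho> B) A"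

  \<comment> \<open>equality\<close>
| Eq_refl: "b \<in> {TyN, TyS, TyT} \<Longrightarrow> typed L [] p b \<Longrightarrow> L \<turnstile> Eq b p p"
| Eq_sym: "b \<in> {TyN, TyS, TyT} \<Longrightarrow> typed L [] p b \<Longrightarrow> typed L [] q b \<Longrightarrow>
    L \<turnstile> Imp (Eq b p q) (Eq b q p)"
| Eq_trans: "b \<in> {TyN, TyS, TyT} \<Longrightarrow> typed L [] p b \<Longrightarrow> typed L [] q b \<Longrightarrow> typed L [] w b \<Longrightarrow>
    L \<turnstile> Imp (Eq b p q) (Imp (Eq b q w) (Eq b p w))"
| Eq_Test: "e \<in> Exps L \<Longrightarrow> typed L [] p TyS \<Longrightarrow> typed L [] q TyS \<Longrightarrow>
    L \<turnstile> Imp (Eq TyS p q) (Imp (Test e p) (Test e q))"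
| Eq_Below: "r \<in> Rels L \<Longrightarrow> typed L [] p TyS \<Longrightarrow> typed L [] p' TyS \<Longrightarrow>
    typed L [] q TyS \<Longrightarrow> typed L [] q' TyS \<Longrightarrow>
    L \<turnstile> Imp (Eq TyS p p') (Imp (Eq TyS q q') (Imp (Below r p q) (Below r p' q')))"
| QF_ER: "L \<turnstile> Imp A (eq_ext \<rho> p q) \<Longrightarrow> wff L [] A \<Longrightarrow> qf A \<Longrightarrow>
    typed L [] p \<rho> \<Longrightarrow> typed L [] q \<rho> \<Longrightarrow> typed L [] w \<sigma> \<Longrightarrow>
    L \<turnstile> Imp A (eq_ext \<sigma> (subst x \<rho> p w) (subst x \<rho> q w))"

  \<comment> \<open>arithmetic\<close>
| Succ_Zero: "typed L [] p TyN \<Longrightarrow> L \<turnstile> Neg (Eq TyN (Succ \<cdot> p) Zero)"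
| Succ_inj: "typed L [] p TyN \<Longrightarrow> typed L [] q TyN \<Longrightarrow>
    L \<turnstile> Imp (Eq TyN (Succ \<cdot> p) (Succ \<cdot> q)) (Eq TyN p q)"
| Induction: "wff L [] A \<Longrightarrow>
    L \<turnstile> Imp (And (substF x TyN Zero A)
                 (all_var x TyN (Imp A (substF x TyN (Succ \<cdot> Free x TyN) A))))
            (all_var x TyN A)"

  \<comment> \<open>System T\<close>
| Beta: "typed L [\<rho>] a \<sigma> \<Longrightarrow> typed L [] b \<rho> \<Longrightarrow> L \<turnstile> eq_ext \<sigma> (Lam \<rho> a \<cdot> b) (inst 0 b a)"
| Rec_Zero: "typed L [] u \<rho> \<Longrightarrow> typed L [] F (TyN \<rightarrow> \<rho> \<rightarrow> \<rho>) \<Longrightarrow>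
    L \<turnstile> eq_ext \<rho> (Rec \<rho> \<cdot> u \<cdot> F \<cdot> Zero) u"
| Rec_Succ: "typed L [] u \<rho> \<Longrightarrow> typed L [] F (TyN \<rightarrow> \<rho> \<rightarrow> \<rho>) \<Longrightarrow> typed L [] p TyN \<Longrightarrow>
    L \<turnstile> eq_ext \<rho> (Rec \<rho> \<cdot> u \<cdot> F \<cdot> (Succ \<cdot> p)) (F \<cdot> p \<cdot> (Rec \<rho> \<cdot> u \<cdot> F \<cdot> p))"
| Fst_Pair: "typed L [] p \<rho> \<Longrightarrow> typed L [] q \<sigma> \<Longrightarrow>
    L \<turnstile> eq_ext \<rho> (Fst \<rho> \<sigma> \<cdot> (Pair \<rho> \<sigma> \<cdot> p \<cdot> q)) p"
| Snd_Pair: "typed L [] p \<rho> \<Longrightarrow> typed L [] q \<sigma> \<Longrightarrow>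
    L \<turnstile> eq_ext \<sigma> (Snd \<rho> \<sigma> \<cdot> (Pair \<rho> \<sigma> \<cdot> p \<cdot> q)) q"

  \<comment> \<open>decidability of state equality and of the predicate and relation symbols\<close>
| Dec_Eq: "b \<in> {TyS, TyT} \<Longrightarrow> typed L [] p b \<Longrightarrow> typed L [] q b \<Longrightarrow>
    L \<turnstile> Or (Eq b p q) (Neg (Eq b p q))"
| Dec_Test: "e \<in> Exps L \<Longrightarrow> typed L [] p TyS \<Longrightarrow> L \<turnstile> Or (Test e p) (Neg (Test e p))"
| Dec_Below: "r \<in> Rels L \<Longrightarrow> typed L [] p TyS \<Longrightarrow> typed L [] q TyS \<Longrightarrow>
    L \<turnstile> Or (Below r p q) (Neg (Below r p q))"
| Cond_True: "e \<in> Exps L \<Longrightarrow> typed L [] p TyS \<Longrightarrow> typed L [] a \<rho> \<Longrightarrow> typed L [] b \<rho> \<Longrightarrow>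
    L \<turnstile> Imp (Test e p) (eq_ext \<rho> (Cond e \<rho> \<cdot> p \<cdot> a \<cdot> b) a)"
| Cond_False: "e \<in> Exps L \<Longrightarrow> typed L [] p TyS \<Longrightarrow> typed L [] a \<rho> \<Longrightarrow> typed L [] b \<rho> \<Longrightarrow>
    L \<turnstile> Imp (Neg (Test e p)) (eq_ext \<rho> (Cond e \<rho> \<cdot> p \<cdot> a \<cdot> b) b)"

  \<comment> \<open>universal axioms, commands, while recursors, wellfounded induction\<close>
| Univ: "A \<in> Univ L \<Longrightarrow> L \<turnstile> A"
| Cmd_eq: "wf_com L C \<Longrightarrow>
    L \<turnstile> eq_ext ((TyS \<rightarrow> TyS) \<otimes> (TyS \<rightarrow> TyT \<rightarrow> TyT)) (Cmd C)
          (Pair (TyS \<rightarrow> TyS) (TyS \<rightarrow> TyT \<rightarrow> TyT) \<cdot> fwd C \<cdot> bwd C)"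
| WhileRec_eq: "r \<in> Rels L \<Longrightarrow> e \<in> Exps L \<Longrightarrow> wf_com L C \<Longrightarrow>
    typed L [] u (TyS \<rightarrow> \<rho>) \<Longrightarrow> typed L [] F (TyS \<rightarrow> \<rho> \<rightarrow> \<rho>) \<Longrightarrow> typed L [] p TyS \<Longrightarrow>
    L \<turnstile> Imp (Imp (Test e p) (Below r (fwd C \<cdot> p) p))
          (eq_ext \<rho> (WhileRec r e (fwd C) \<rho> \<cdot> u \<cdot> F \<cdot> p)
             (Cond e \<rho> \<cdot> p \<cdot> (F \<cdot> p \<cdot> (WhileRec r e (fwd C) \<rho> \<cdot> u \<cdot> F \<cdot> (fwd C \<cdot> p))) \<cdot> (u \<cdot> p)))"
| WF_Ind: "r \<in> Rels L \<Longrightarrow> wff L [] A \<Longrightarrow> y \<noteq> x \<Longrightarrow> (y, TyS) \<notin> fvF A \<Longrightarrow>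
    L \<turnstile> all_var x TyS
          (Imp (all_var y TyS (Imp (Below r (Free y TyS) (Free x TyS)) (substF x TyS (Free y TyS) A)))
               A) \<Longrightarrow>
    L \<turnstile> all_var x TyS A"


section \<open>Triples\<close>

text \<open>Assertions about the state variables \<open>s\<close> and \<open>t\<close>; parameters of types other than the two
  state types are allowed.\<close>

definition assertion ::
  "('c, 'g, 'e, 'r) extn \<Rightarrow> nat \<Rightarrow> nat \<Rightarrow> ('c, 'g, 'e, 'r) fm \<Rightarrow> bool" where
  "assertion L s t P \<longleftrightarrow> wff L [] P \<and> qf P \<and>
     (\<forall>(x, \<rho>) \<in> fvF P. \<rho> \<in> {TyS, TyT} \<longrightarrow> (x, \<rho>) \<in> {(s, TyS), (t, TyT)})"

definition triple ::
  "nat \<Rightarrow> nat \<Rightarrow> ('c, 'g, 'e, 'r) fm \<Rightarrow> ('c, 'g, 'e, 'r) com \<Rightarrow> ('c, 'g, 'e, 'r) fm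
    \<Rightarrow> ('c, 'g, 'e, 'r) fm" where
  "triple s t P C Q = all_var s TyS (all_var t TyT
     (Imp (substF t TyT (bwd C \<cdot> Free s TyS \<cdot> Free t TyT) P)
          (substF s TyS (fwd C \<cdot> Free s TyS) Q)))"

definition or_if :: "nat \<Rightarrow> 'e \<Rightarrow> ('c, 'g, 'e, 'r) fm \<Rightarrow> ('c, 'g, 'e, 'r) fm \<Rightarrow> ('c, 'g, 'e, 'r) fm" where
  "or_if s e P Q = And (Imp (Test e (Free s TyS)) P) (Imp (Neg (Test e (Free s TyS))) Q)"

end

theory Submission
  imports Defs
begin

text \<open>
  Each rule is an instance of the soundness of the Dialectica interpretation: after unfolding
  \<open>C\<^sup>+\<close> and \<open>C\<^sup>-\<close> on the state variables by \<open>\<beta>\<close>-conversion and the defining equations of the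
  conditional and the recursor, the conclusion follows from instances of the premises. All
  rewriting takes place in quantifier-free formulas at the base types S and T and under a
  quantifier-free hypothesis (\<open>\<phi>(s)\<close> or \<open>\<not>\<phi>(s)\<close>), which is what the weak extensionality rule
  allows. For the loop, wellfounded induction on \<open>s\<close> is applied to the formula
  \<open>\<forall>t (P(s, W\<^sup>- s t) \<rightarrow> (P \<and> \<not>\<phi>)(W\<^sup>+ s, t))\<close> for all \<open>t\<close> simultaneously, since the induction
  hypothesis at \<open>C\<^sup>+ s\<close> is combined with the premise at the backward state \<open>W\<^sup>- (C\<^sup>+ s) t\<close>.
\<close>

section \<open>Substitution and typing\<close>

lemma typed_append: "typed L \<Gamma> a \<sigma> \<Longrightarrow> typed L (\<Gamma> @ \<Delta>) a \<sigma>"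
proof (induction rule: typed.induct)
  case (Bd i \<Gamma>)
  then show ?case using typed.Bd[of i "\<Gamma> @ \<Delta>" L] by (simp add: nth_append)
qed (auto intro: typed.intros)

lemma typed_closed: "typed L [] a \<sigma> \<Longrightarrow> typed L \<Gamma> a \<sigma>"
  using typed_append[of L "[]" a \<sigma> \<Gamma>] by simp

lemma typed_BdI: "i < length \<Gamma> \<Longrightarrow> \<Gamma> ! i = \<rho> \<Longrightarrow> typed L \<Gamma> (Bd i) \<rho>"
  using typed.Bd by blast

text \<open>The instantiated index is the outermost one, so its type stands last in the context.
  Passing a binder pushes a type at the front, which raises \<open>length \<Gamma>\<close> by one in
  step with the \<open>Suc k\<close> of \<open>inst\<close>. The same convention governs
  \<open>typed_bind\<close> and \<open>typed_lift\<close>.\<close>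

lemma typed_inst:
  assumes "typed L (\<Gamma> @ [\<rho>]) a \<sigma>" and "typed L [] u \<rho>"
  shows "typed L \<Gamma> (inst (length \<Gamma>) u a) \<sigma>"
  using assms
proof (induction "\<Gamma> @ [\<rho>]" a \<sigma> arbitrary: \<Gamma> rule: typed.induct)
  case (Bd i)
  then show ?case
    by (cases "i = length \<Gamma>") (auto simp: nth_append intro: typed_closed typed_BdI)
next
  case (Lam \<rho>' a \<sigma>)
  then show ?case using Lam(2)[of "\<rho>' # \<Gamma>"] by (auto intro: typed.intros)
qed (auto intro: typed.intros)

lemma typed_bind: "typed L \<Gamma> a \<sigma> \<Longrightarrow> typed L (\<Gamma> @ [\<tau>]) (bind (length \<Gamma>) x \<tau> a) \<sigma>"
proof (induction rule: typed.induct)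
  case (Bd i \<Gamma>)
  then show ?case by (auto simp: nth_append intro: typed_BdI)
next
  case (Free \<Gamma> y \<rho>)
  then show ?case by (auto intro: typed_BdI typed.intros)
qed (auto intro: typed.intros)

lemma typed_lift:
  assumes "typed L (\<Gamma> @ \<Delta>) a \<sigma>"
  shows "typed L (\<Gamma> @ \<rho> # \<Delta>) (lift (length \<Gamma>) a) \<sigma>"
  using assms
proof (induction "\<Gamma> @ \<Delta>" a \<sigma> arbitrary: \<Gamma> rule: typed.induct)
  case (Bd i)
  then show ?case by (auto simp: nth_append Suc_diff_le intro!: typed_BdI)
next
  case (Lam \<rho>' a \<sigma>)
  then show ?case using Lam(2)[of "\<rho>' # \<Gamma>"] by (auto intro: typed.intros)
qed (auto intro: typed.intros)

lemma typed_subst: "typed L \<Gamma> a \<sigma> \<Longrightarrow> typed L [] u \<tau> \<Longrightarrow> typed L \<Gamma> (subst x \<tau> u a) \<sigma>"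
  by (induction rule: typed.induct) (auto intro: typed.intros typed_closed)

section \<open>Interaction of instantiation, lifting, binding and substitution\<close>

lemma inst_typed: "typed L \<Gamma> a \<sigma> \<Longrightarrow> length \<Gamma> \<le> k \<Longrightarrow> inst k u a = a"
  by (induction arbitrary: k rule: typed.induct) auto

lemma lift_typed: "typed L \<Gamma> a \<sigma> \<Longrightarrow> length \<Gamma> \<le> k \<Longrightarrow> lift k a = a"
  by (induction arbitrary: k rule: typed.induct) auto

text \<open>Used to push an instantiation through \<open>eq_ext\<close>, which lifts its arguments
  under a quantifier at function types. Being locally closed, \<open>u\<close> is fixed by
  lifting.\<close>

lemma inst_Suc_lift:
  "typed L [] u \<tau> \<Longrightarrow> j \<le> k \<Longrightarrow> inst (Suc k) u (lift j a) = lift j (inst k u a)"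
  by (induction a arbitrary: j k) (auto simp: lift_typed)

text \<open>Typedness in \<open>\<Gamma>\<close> keeps the index \<open>length \<Gamma>\<close> from
  dangling in \<open>a\<close> beforehand, so \<open>inst\<close> hits exactly the occurrences that
  \<open>bind\<close> has written.\<close>

lemma inst_bind: "typed L \<Gamma> a \<sigma> \<Longrightarrow> inst (length \<Gamma>) u (bind (length \<Gamma>) x \<tau> a) = subst x \<tau> u a"
  by (induction rule: typed.induct) auto

lemma subst_subst_same: "subst x \<tau> v (subst x \<tau> u a) = subst x \<tau> (subst x \<tau> v u) a"
  by (induction a) auto

lemma subst_fresh: "(x, \<tau>) \<notin> fv a \<Longrightarrow> subst x \<tau> u a = a"
  by (induction a) auto

lemma subst_subst:
  "(x, \<tau>) \<noteq> (y, \<sigma>) \<Longrightarrow> (x, \<tau>) \<notin> fv v \<Longrightarrow>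
    subst y \<sigma> v (subst x \<tau> u a) = subst x \<tau> (subst y \<sigma> v u) (subst y \<sigma> v a)"
  by (induction a) (auto simp: subst_fresh)

lemma subst_rename: "(y, \<tau>) \<notin> fv a \<Longrightarrow> subst y \<tau> u (subst x \<tau> (Free y \<tau>) a) = subst x \<tau> u a"
  by (induction a) auto

lemma bind_fresh: "(x, \<tau>) \<notin> fv a \<Longrightarrow> bind k x \<tau> a = a"
  by (induction a arbitrary: k) auto

lemma bind_subst:
  "(x, \<tau>) \<noteq> (y, \<sigma>) \<Longrightarrow> (x, \<tau>) \<notin> fv v \<Longrightarrow>
    bind k x \<tau> (subst y \<sigma> v a) = subst y \<sigma> v (bind k x \<tau> a)"
  by (induction a arbitrary: k) (auto simp: bind_fresh)

lemma fv_bind: "fv (bind k x \<tau> a) = fv a - {(x, \<tau>)}"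
  by (induction a arbitrary: k) auto

lemma finite_fv: "finite (fv a)"
  by (induction a) auto

section \<open>The same facts for formulas\<close>

lemma wff_inst:
  "wff L (\<Gamma> @ [\<rho>]) A \<Longrightarrow> typed L [] u \<rho> \<Longrightarrow> wff L \<Gamma> (instF (length \<Gamma>) u A)"
proof (induction A arbitrary: \<Gamma>)
  case (All \<sigma> A)
  then show ?case using All(1)[of "\<sigma> # \<Gamma>"] by simp
next
  case (Ex \<sigma> A)
  then show ?case using Ex(1)[of "\<sigma> # \<Gamma>"] by simp
qed (auto intro: typed_inst)

lemma wff_bind: "wff L \<Gamma> A \<Longrightarrow> wff L (\<Gamma> @ [\<tau>]) (bindF (length \<Gamma>) x \<tau> A)"
proof (induction A arbitrary: \<Gamma>)
  case (All \<sigma> A)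
  then show ?case using All(1)[of "\<sigma> # \<Gamma>"] by simp
next
  case (Ex \<sigma> A)
  then show ?case using Ex(1)[of "\<sigma> # \<Gamma>"] by simp
qed (auto intro: typed_bind)

lemma wff_all_var: "wff L [] A \<Longrightarrow> wff L [] (all_var x \<tau> A)"
  using wff_bind[of L "[]"] by (simp add: all_var_def)

lemma wff_ex_var: "wff L [] A \<Longrightarrow> wff L [] (ex_var x \<tau> A)"
  using wff_bind[of L "[]"] by (simp add: ex_var_def)

lemma wff_subst: "wff L \<Gamma> A \<Longrightarrow> typed L [] u \<tau> \<Longrightarrow> wff L \<Gamma> (substF x \<tau> u A)"
  by (induction A arbitrary: \<Gamma>) (auto intro: typed_subst)

lemma wff_eq_ext: "typed L \<Gamma> p \<sigma> \<Longrightarrow> typed L \<Gamma> q \<sigma> \<Longrightarrow> wff L \<Gamma> (eq_ext \<sigma> p q)"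
proof (induction \<sigma> p q arbitrary: \<Gamma> rule: eq_ext.induct)
  case (4 \<rho> \<sigma> p q)
  have "typed L (\<rho> # \<Gamma>) (lift 0 p \<cdot> Bd 0) \<sigma>" "typed L (\<rho> # \<Gamma>) (lift 0 q \<cdot> Bd 0) \<sigma>"
    using 4(2,3) typed_lift[of L "[]" \<Gamma> _ "\<rho> \<rightarrow> \<sigma>" \<rho>]
    by (auto intro!: typed.App[where \<rho> = \<rho>] typed_BdI)
  then show ?case using 4(1) by simp
qed (auto intro: typed.intros)

lemma instF_bind: "wff L \<Gamma> A \<Longrightarrow> instF (length \<Gamma>) u (bindF (length \<Gamma>) x \<tau> A) = substF x \<tau> u A"
proof (induction A arbitrary: \<Gamma>)
  case (All \<sigma> A)
  then show ?case using All(1)[of "\<sigma> # \<Gamma>"] by simp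
next
  case (Ex \<sigma> A)
  then show ?case using Ex(1)[of "\<sigma> # \<Gamma>"] by simp
qed (auto simp: inst_bind)

lemma instF_eq_ext:
  assumes "typed L [] u \<tau>"
  shows "instF k u (eq_ext \<sigma> p q) = eq_ext \<sigma> (inst k u p) (inst k u q)"
  by (induction \<sigma> p q arbitrary: k rule: eq_ext.induct) (auto simp: inst_Suc_lift[OF assms])

lemma substF_same: "substF x \<tau> v (substF x \<tau> u A) = substF x \<tau> (subst x \<tau> v u) A"
  by (induction A) (auto simp: subst_subst_same)

lemma substF_substF:
  "(x, \<tau>) \<noteq> (y, \<sigma>) \<Longrightarrow> (x, \<tau>) \<notin> fv v \<Longrightarrow>
    substF y \<sigma> v (substF x \<tau> u A) = substF x \<tau> (subst y \<sigma> v u) (substF y \<sigma> v A)"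
  by (induction A) (auto simp: subst_subst)

lemma substF_rename:
  "(y, \<tau>) \<notin> fvF A \<Longrightarrow> substF y \<tau> u (substF x \<tau> (Free y \<tau>) A) = substF x \<tau> u A"
  by (induction A) (auto simp: subst_rename)

lemma subst_self: "subst x \<tau> (Free x \<tau>) a = a"
  by (induction a) auto

lemma substF_self: "substF x \<tau> (Free x \<tau>) A = A"
  by (induction A) (auto simp: subst_self)

lemma bindF_substF:
  "(x, \<tau>) \<noteq> (y, \<sigma>) \<Longrightarrow> (x, \<tau>) \<notin> fv v \<Longrightarrow>
    bindF k x \<tau> (substF y \<sigma> v A) = substF y \<sigma> v (bindF k x \<tau> A)"
  by (induction A arbitrary: k) (auto simp: bind_subst)

lemma substF_all_var:
  "(x, \<tau>) \<noteq> (y, \<sigma>) \<Longrightarrow> (x, \<tau>) \<notin> fv v \<Longrightarrow>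
    substF y \<sigma> v (all_var x \<tau> A) = all_var x \<tau> (substF y \<sigma> v A)"
  by (simp add: all_var_def bindF_substF)

lemma fvF_bind: "fvF (bindF k x \<tau> A) = fvF A - {(x, \<tau>)}"
  by (induction A arbitrary: k) (auto simp: fv_bind)

lemma fvF_all_var: "fvF (all_var x \<tau> A) = fvF A - {(x, \<tau>)}"
  by (simp add: all_var_def fvF_bind)

lemma fv_subst: "fv (subst x \<tau> u a) \<subseteq> fv a \<union> fv u"
  by (induction a) auto

lemma fvF_substF: "fvF (substF x \<tau> u A) \<subseteq> fvF A \<union> fv u"
  by (induction A) (auto dest: subsetD[OF fv_subst])

lemma finite_fvF: "finite (fvF A)"
  by (induction A) (auto simp: finite_fv)

lemma ex_fresh: "\<exists>y. y \<noteq> x \<and> (y, \<tau>) \<notin> fvF A"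
proof -
  have "finite (insert x (fst ` fvF A))" by (simp add: finite_fvF)
  then obtain y where "y \<notin> insert x (fst ` fvF A)" using ex_new_if_finite infinite_UNIV_nat by blast
  then show ?thesis by force
qed

section \<open>Closedness and types of the forward and backward parts\<close>

lemma fwd_closed [simp]:
  "inst k u (fwd C) = fwd C" "lift k (fwd C) = fwd C" "subst x \<tau> u (fwd C) = fwd C" "fv (fwd C) = {}"
  by (induction C arbitrary: k) auto

lemma bwd_closed [simp]:
  "inst k u (bwd C) = bwd C" "lift k (bwd C) = bwd C" "subst x \<tau> u (bwd C) = bwd C" "fv (bwd C) = {}"
  by (induction C arbitrary: k) auto

inductive_simps typed_simps:
  "typed L \<Gamma> (Free x \<rho>) \<sigma>" "typed L \<Gamma> (Bd i) \<sigma>" "typed L \<Gamma> (a \<cdot> b) \<sigma>" "typed L \<Gamma> (Lam \<rho> a) \<sigma>"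
  "typed L \<Gamma> (CmdF c) \<sigma>" "typed L \<Gamma> (CmdB g) \<sigma>" "typed L \<Gamma> (Cond e \<rho>) \<sigma>"
  "typed L \<Gamma> (WhileRec r e d \<rho>) \<sigma>" "typed L \<Gamma> Zero \<sigma>" "typed L \<Gamma> Succ \<sigma>"
  "typed L \<Gamma> (Rec \<rho>) \<sigma>" "typed L \<Gamma> (Pair \<rho> \<rho>') \<sigma>" "typed L \<Gamma> (Fst \<rho> \<rho>') \<sigma>"
  "typed L \<Gamma> (Snd \<rho> \<rho>') \<sigma>" "typed L \<Gamma> (Cmd C) \<sigma>"

text \<open>With unique types, a typing judgment for a closed term becomes an equation between
  types. Through \<open>typed_iffI\<close> this lets the simplifier decide the typing of terms built
  from \<open>fwd C\<close> and \<open>bwd C\<close>.\<close>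

lemma typed_unique: "typed L \<Gamma> a \<sigma> \<Longrightarrow> typed L \<Gamma> a \<tau> \<Longrightarrow> \<sigma> = \<tau>"
proof (induction arbitrary: \<tau> rule: typed.induct)
  case (App \<Gamma> a \<rho> \<sigma> b)
  from App.prems obtain \<rho>' where "typed L \<Gamma> a (\<rho>' \<rightarrow> \<tau>)" by (auto simp only: typed_simps)
  from App.IH(1)[OF this] show ?case by simp
next
  case (Lam \<rho> \<Gamma> a \<sigma>)
  from Lam.prems obtain \<sigma>' where "\<tau> = \<rho> \<rightarrow> \<sigma>'" "typed L (\<rho> # \<Gamma>) a \<sigma>'"
    by (auto simp only: typed_simps)
  with Lam.IH show ?case by blast
qed (auto simp only: typed_simps)

text \<open>The raw inversion rule asks for some well-formed command whose forward part is the
  index, and \<open>fwd\<close> is not injective. The given \<open>C\<close> serves as the witness,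
  so no existential remains for the simplifier.\<close>

lemma typed_WhileRec_iff:
  "wf_com L C \<Longrightarrow> typed L \<Gamma> (WhileRec r e (fwd C) \<rho>) \<sigma> \<longleftrightarrow>
    r \<in> Rels L \<and> e \<in> Exps L \<and> \<sigma> = (TyS \<rightarrow> \<rho>) \<rightarrow> (TyS \<rightarrow> \<rho> \<rightarrow> \<rho>) \<rightarrow> TyS \<rightarrow> \<rho>"
  by (auto simp: typed_simps)

lemma typed_iffI: "(\<And>\<Gamma>. typed L \<Gamma> a \<sigma>) \<Longrightarrow> typed L \<Gamma> a \<tau> \<longleftrightarrow> \<tau> = \<sigma>"
  using typed_unique by blast

lemma typed_fwd: "wf_com L C \<Longrightarrow> typed L \<Gamma> (fwd C) (TyS \<rightarrow> TyS)"
proof (induction C arbitrary: \<Gamma>)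
  case (Seq C1 C2)
  then have "\<And>\<Delta>. typed L \<Delta> (fwd C1) (TyS \<rightarrow> TyS)" "\<And>\<Delta>. typed L \<Delta> (fwd C2) (TyS \<rightarrow> TyS)"
    by auto
  from this[THEN typed_iffI] show ?case by (simp add: typed_simps)
next
  case (If e C1 C2)
  then have "\<And>\<Delta>. typed L \<Delta> (fwd C1) (TyS \<rightarrow> TyS)" "\<And>\<Delta>. typed L \<Delta> (fwd C2) (TyS \<rightarrow> TyS)"
    by auto
  from this[THEN typed_iffI] If.prems show ?case by (simp add: typed_simps)
qed (auto simp: typed_simps)

lemma typed_fwd_iff: "wf_com L C \<Longrightarrow> typed L \<Gamma> (fwd C) \<sigma> \<longleftrightarrow> \<sigma> = TyS \<rightarrow> TyS"
  by (rule typed_iffI) (rule typed_fwd)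

lemma typed_bwd: "wf_com L C \<Longrightarrow> typed L \<Gamma> (bwd C) (TyS \<rightarrow> TyT \<rightarrow> TyT)"
proof (induction C arbitrary: \<Gamma>)
  case (Seq C1 C2)
  then have "\<And>\<Delta>. typed L \<Delta> (bwd C1) (TyS \<rightarrow> TyT \<rightarrow> TyT)"
    "\<And>\<Delta>. typed L \<Delta> (bwd C2) (TyS \<rightarrow> TyT \<rightarrow> TyT)" by auto
  from this[THEN typed_iffI] Seq.prems show ?case by (simp add: typed_simps typed_fwd_iff)
next
  case (If e C1 C2)
  then have "\<And>\<Delta>. typed L \<Delta> (bwd C1) (TyS \<rightarrow> TyT \<rightarrow> TyT)"
    "\<And>\<Delta>. typed L \<Delta> (bwd C2) (TyS \<rightarrow> TyT \<rightarrow> TyT)" by auto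
  from this[THEN typed_iffI] If.prems show ?case by (simp add: typed_simps)
next
  case (While r e C)
  then have "\<And>\<Delta>. typed L \<Delta> (bwd C) (TyS \<rightarrow> TyT \<rightarrow> TyT)" by auto
  from this[THEN typed_iffI] While.prems show ?case by (auto simp: typed_simps numeral_2_eq_2)
qed (auto simp: typed_simps)

lemma typed_bwd_iff: "wf_com L C \<Longrightarrow> typed L \<Gamma> (bwd C) \<sigma> \<longleftrightarrow> \<sigma> = TyS \<rightarrow> TyT \<rightarrow> TyT"
  by (rule typed_iffI) (rule typed_bwd)

lemmas typing = typed_simps(1-7) typed_WhileRec_iff typed_fwd_iff typed_bwd_iff

section \<open>Deduction from hypotheses\<close>

locale extension =
  fixes L :: "('c, 'g, 'e, 'r) extn"
  assumes wf: "wf_extn L"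
begin

text \<open>Lets later arguments read well-formedness off derivations. For the universal axioms it
  comes from \<open>wf_extn\<close>; all other cases follow from the side conditions of the
  calculus.\<close>

lemma provable_wff: "L \<turnstile> A \<Longrightarrow> wff L [] A"
proof (induction rule: provable.induct)
  case (All_E \<rho> A u)
  then show ?case using wff_inst[of L "[]" \<rho> A u] by simp
next
  case (Ex_I \<rho> A u)
  then show ?case using wff_inst[of L "[]" \<rho> A u] by simp
next
  case (Beta \<rho> a \<sigma> b)
  then show ?case
    using typed_inst[of L "[]" \<rho> a \<sigma> b] by (auto intro!: wff_eq_ext intro: typed.intros)
next
  case (Univ A)
  then show ?case using wf by (auto simp: wf_extn_def)
next
  case (Cmd_eq C)
  then show ?case
    by (intro wff_eq_ext) (simp_all add: typing typed.Cmd, fastforce intro: typed.intros)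
next
  case (WhileRec_eq r e C u \<rho> F p)
  then have "typed L [] (fwd C) (TyS \<rightarrow> TyS)"
    "typed L [] (WhileRec r e (fwd C) \<rho>) ((TyS \<rightarrow> \<rho>) \<rightarrow> (TyS \<rightarrow> \<rho> \<rightarrow> \<rho>) \<rightarrow> TyS \<rightarrow> \<rho>)"
    "typed L [] (Cond e \<rho>) (TyS \<rightarrow> \<rho> \<rightarrow> \<rho> \<rightarrow> \<rho>)"
    by (auto simp: typing)
  with WhileRec_eq show ?case by (auto intro!: wff_eq_ext) (blast intro: typed.App)+
next
  case (Induction A x)
  have "typed L [] (Succ \<cdot> Free x TyN) TyN" by (simp add: typed_simps)
  with Induction show ?case by (auto intro!: wff_all_var wff_subst intro: typed.intros)
next
  case (Rec_Succ u \<rho> F p)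
  then have "typed L [] (Rec \<rho> \<cdot> u \<cdot> F \<cdot> p) \<rho>" "typed L [] (Rec \<rho> \<cdot> u \<cdot> F \<cdot> (Succ \<cdot> p)) \<rho>"
    "typed L [] (F \<cdot> p) (\<rho> \<rightarrow> \<rho>)"
    by (auto intro: typed.intros)
  then show ?case by (auto intro: wff_eq_ext typed.App)
qed (auto intro!: wff_all_var wff_ex_var wff_subst wff_eq_ext intro: typed.intros typed_subst)

text \<open>Hypotheses may be combined by modus ponens only; generalization, extensionality and
  wellfounded induction enter solely through finished theorems. This is what keeps the deduction
  theorem valid although \<open>QF_ER\<close> and \<open>WF_Ind\<close> are rules for
  theorems.\<close>

inductive ent :: "('c, 'g, 'e, 'r) fm set \<Rightarrow> ('c, 'g, 'e, 'r) fm \<Rightarrow> bool"  (infix "\<tturnstile>" 50)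
  for \<Gamma> where
  hyp: "A \<in> \<Gamma> \<Longrightarrow> wff L [] A \<Longrightarrow> \<Gamma> \<tturnstile> A"
| prov: "L \<turnstile> A \<Longrightarrow> \<Gamma> \<tturnstile> A"
| mp: "\<Gamma> \<tturnstile> Imp A B \<Longrightarrow> \<Gamma> \<tturnstile> A \<Longrightarrow> \<Gamma> \<tturnstile> B"

lemma ent_wff: "\<Gamma> \<tturnstile> A \<Longrightarrow> wff L [] A"
  by (induction rule: ent.induct) (auto intro: provable_wff)

lemma ent_empty: "{} \<tturnstile> A \<longleftrightarrow> L \<turnstile> A"
proof
  assume "{} \<tturnstile> A"
  then show "L \<turnstile> A" by (induction rule: ent.induct) (auto intro: provable.MP)
qed (rule prov)

lemma weaken: "\<Gamma> \<tturnstile> A \<Longrightarrow> \<Gamma> \<subseteq> \<Delta> \<Longrightarrow> \<Delta> \<tturnstile> A"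
  by (induction rule: ent.induct) (auto intro: ent.intros)

text \<open>Modus ponens is the only rule acting on hypotheses, so the combinators K and S carry the
  implication through the whole derivation.\<close>

lemma deduct:
  assumes "insert A \<Gamma> \<tturnstile> B" and A: "wff L [] A"
  shows "\<Gamma> \<tturnstile> Imp A B"
proof -
  have K: "\<Gamma> \<tturnstile> B \<Longrightarrow> \<Gamma> \<tturnstile> Imp A B" for B
    using Imp_K[of L B A] A ent_wff by (blast intro: prov mp)
  \<comment> \<open>The identity as S K K, with \<open>Imp A A\<close> as the intermediate
    formula.\<close>
  have I: "\<Gamma> \<tturnstile> Imp A A"
    using Imp_K[of L A A] Imp_K[of L A "Imp A A"] Imp_S[of L A "Imp A A" A] A
    by (meson prov mp wff.simps)
  show ?thesis using assms(1)
  proof (induction rule: ent.induct)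
    case (hyp B)
    then show ?case using I K ent.hyp by blast
  next
    case (prov B)
    then show ?case using K ent.prov by blast
  next
    case (mp B D)
    have "wff L [] B" "wff L [] D" using ent_wff[OF mp.hyps(1)] by auto
    then show ?case using mp.IH Imp_S[of L A B D] A by (meson ent.prov ent.mp)
  qed
qed

lemma cut: "\<Gamma> \<tturnstile> A \<Longrightarrow> {A} \<tturnstile> B \<Longrightarrow> \<Gamma> \<tturnstile> B"
  by (metis deduct mp weaken empty_subsetI ent_wff)

section \<open>Derived rules for connectives and quantifiers\<close>

lemma andI: "\<Gamma> \<tturnstile> A \<Longrightarrow> \<Gamma> \<tturnstile> B \<Longrightarrow> \<Gamma> \<tturnstile> And A B"
  by (meson And_I ent_wff mp prov)

lemma andE1: "\<Gamma> \<tturnstile> And A B \<Longrightarrow> \<Gamma> \<tturnstile> A"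
  using ent_wff[of \<Gamma> "And A B"] by (auto intro: mp prov And_E1)

lemma andE2: "\<Gamma> \<tturnstile> And A B \<Longrightarrow> \<Gamma> \<tturnstile> B"
  using ent_wff[of \<Gamma> "And A B"] by (auto intro: mp prov And_E2)

lemma orE:
  assumes "\<Gamma> \<tturnstile> Or A B" and "insert A \<Gamma> \<tturnstile> D" and "insert B \<Gamma> \<tturnstile> D"
  shows "\<Gamma> \<tturnstile> D"
proof -
  have "wff L [] A" "wff L [] B" "wff L [] D"
    using ent_wff[OF assms(1)] ent_wff[OF assms(2)] by auto
  then show ?thesis using Or_E[of L A B D] assms deduct by (meson mp prov)
qed

lemma orI1: "\<Gamma> \<tturnstile> A \<Longrightarrow> wff L [] B \<Longrightarrow> \<Gamma> \<tturnstile> Or A B"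
  using Or_I1 ent_wff mp prov by blast

lemma orI2: "\<Gamma> \<tturnstile> B \<Longrightarrow> wff L [] A \<Longrightarrow> \<Gamma> \<tturnstile> Or A B"
  using Or_I2 ent_wff mp prov by blast

lemma specialize:
  assumes "\<Gamma> \<tturnstile> all_var x \<tau> A" and "wff L [] A" and "typed L [] u \<tau>"
  shows "\<Gamma> \<tturnstile> substF x \<tau> u A"
  using assms All_E[of L \<tau> "bindF 0 x \<tau> A" u] wff_all_var[of L A x \<tau>] instF_bind[of L "[]" A u x \<tau>]
  by (metis all_var_def list.size(3) mp prov)

lemma generalize:
  assumes "L \<turnstile> A"
  shows "L \<turnstile> all_var x \<tau> A"
proof -
  \<comment> \<open>\<open>All_I\<close> generalizes only the conclusion of an implication; a
    provable antecedent without free variables meets its side condition and is then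
    detached.\<close>
  have T: "L \<turnstile> Imp Bot Bot" by (rule Bot_E) simp
  have "{} \<tturnstile> Imp (Imp Bot Bot) A" using assms by (intro deduct prov) simp_all
  then have "L \<turnstile> Imp (Imp Bot Bot) (all_var x \<tau> A)" by (intro All_I) (simp_all add: ent_empty)
  with T show ?thesis by (rule MP[rotated])
qed

lemma instantiate: "L \<turnstile> all_var x \<tau> A \<Longrightarrow> wff L [] A \<Longrightarrow> typed L [] u \<tau> \<Longrightarrow> L \<turnstile> substF x \<tau> u A"
  using specialize ent_empty by blast

section \<open>Rewriting in quantifier-free formulas\<close>

text \<open>Equality at a function type is by definition a universal formula, so this is a
  specialization; the lifting in \<open>eq_ext\<close> disappears because \<open>p\<close> and
  \<open>q\<close> are locally closed.\<close>

lemma eq_app: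
  assumes "\<Gamma> \<tturnstile> eq_ext (\<rho> \<rightarrow> \<sigma>) p q" and "typed L [] p (\<rho> \<rightarrow> \<sigma>)" "typed L [] q (\<rho> \<rightarrow> \<sigma>)"
    and u: "typed L [] u \<rho>"
  shows "\<Gamma> \<tturnstile> eq_ext \<sigma> (p \<cdot> u) (q \<cdot> u)"
proof -
  have "instF 0 u (eq_ext \<sigma> (lift 0 p \<cdot> Bd 0) (lift 0 q \<cdot> Bd 0)) = eq_ext \<sigma> (p \<cdot> u) (q \<cdot> u)"
    by (simp add: instF_eq_ext[OF u] assms(2,3)[THEN lift_typed] assms(2,3)[THEN inst_typed])
  with assms(1) u show ?thesis
    using All_E[of L \<rho> "eq_ext \<sigma> (lift 0 p \<cdot> Bd 0) (lift 0 q \<cdot> Bd 0)" u] ent_wff[OF assms(1)]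
    by (simp del: wff.simps) (blast intro: mp prov)
qed

lemma eq_sym: "\<Gamma> \<tturnstile> Eq b p q \<Longrightarrow> \<Gamma> \<tturnstile> Eq b q p"
  using ent_wff[of \<Gamma> "Eq b p q"] Eq_sym[of b L p q] by (auto intro: mp prov)

lemma eq_trans: "\<Gamma> \<tturnstile> Eq b p q \<Longrightarrow> \<Gamma> \<tturnstile> Eq b q w \<Longrightarrow> \<Gamma> \<tturnstile> Eq b p w"
  using ent_wff[of \<Gamma> "Eq b p q"] ent_wff[of \<Gamma> "Eq b q w"] Eq_trans[of b L p q w]
  by (meson mp prov wff.simps)

text \<open>\<open>QF_ER\<close> in hypothetical form. The single hypothesis \<open>G\<close> is
  moved to the antecedent, where the rule demands a quantifier-free formula, and is recovered
  afterwards.\<close>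

lemma eq_subst:
  assumes "{G} \<tturnstile> eq_ext \<rho> p q" "qf G" "wff L [] G"
    and "typed L [] p \<rho>" "typed L [] q \<rho>" "typed L [] w \<sigma>"
  shows "{G} \<tturnstile> eq_ext \<sigma> (subst x \<rho> p w) (subst x \<rho> q w)"
proof -
  have "L \<turnstile> Imp G (eq_ext \<rho> p q)" using deduct assms ent_empty by blast
  then have "L \<turnstile> Imp G (eq_ext \<sigma> (subst x \<rho> p w) (subst x \<rho> q w))" using QF_ER assms by blast
  then show ?thesis using assms(3) by (blast intro: mp prov hyp)
qed

text \<open>Both directions are proved together, since an implication is contravariant in its
  antecedent. Atoms have arguments of base type, where \<open>eq_ext\<close> is primitive equality,
  so \<open>eq_subst\<close> followed by the equality axioms settles them.\<close>

lemma replace_iff: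
  assumes eq: "{G} \<tturnstile> eq_ext \<rho> p q" and G: "qf G" "wff L [] G"
    and ty: "typed L [] p \<rho>" "typed L [] q \<rho>"
    and "qf P" "wff L [] P"
  shows "{G} \<tturnstile> Imp (substF x \<rho> p P) (substF x \<rho> q P) \<and>
    {G} \<tturnstile> Imp (substF x \<rho> q P) (substF x \<rho> p P)"
  using assms(6,7)
proof (induction P)
  case Bot
  then show ?case by (simp add: deduct hyp)
next
  case (Eq b a1 a2)
  define p1 p2 q1 q2 where d: "p1 = subst x \<rho> p a1" "p2 = subst x \<rho> p a2"
    "q1 = subst x \<rho> q a1" "q2 = subst x \<rho> q a2"
  have *: "{G} \<tturnstile> Eq b p1 q1" "{G} \<tturnstile> Eq b p2 q2"
    using eq_subst[OF eq G ty] Eq by (auto simp: d) fastforce+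
  have w: "wff L [] (Eq b p1 p2)" "wff L [] (Eq b q1 q2)"
    using Eq ty by (auto simp: d intro: typed_subst)
  have *: "insert A {G} \<tturnstile> Eq b p1 q1" "insert A {G} \<tturnstile> Eq b p2 q2" for A
    using * weaken by blast+
  have "insert (Eq b p1 p2) {G} \<tturnstile> Eq b q1 q2" "insert (Eq b q1 q2) {G} \<tturnstile> Eq b p1 p2"
    using * w by (meson eq_sym eq_trans hyp insertI1)+
  then show ?case using w by (auto simp: d intro: deduct)
next
  case (Test e a)
  define p1 q1 where d: "p1 = subst x \<rho> p a" "q1 = subst x \<rho> q a"
  have *: "{G} \<tturnstile> Eq TyS p1 q1"
    using eq_subst[OF eq G ty, of a TyS] Test by (auto simp: d)
  have "typed L [] p1 TyS" "typed L [] q1 TyS"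
    using Test ty by (auto simp: d intro: typed_subst)
  then have "{G} \<tturnstile> Imp (Test e p1) (Test e q1)" "{G} \<tturnstile> Imp (Test e q1) (Test e p1)"
    using * eq_sym[OF *] Test by (auto intro: mp prov Eq_Test)
  then show ?case by (simp add: d)
next
  case (Below r a1 a2)
  define p1 p2 q1 q2 where d: "p1 = subst x \<rho> p a1" "p2 = subst x \<rho> p a2"
    "q1 = subst x \<rho> q a1" "q2 = subst x \<rho> q a2"
  have *: "{G} \<tturnstile> Eq TyS p1 q1" "{G} \<tturnstile> Eq TyS p2 q2"
    using eq_subst[OF eq G ty, of _ TyS] Below by (auto simp: d)
  have "typed L [] p1 TyS" "typed L [] q1 TyS" "typed L [] p2 TyS" "typed L [] q2 TyS"
    using Below ty by (auto simp: d intro: typed_subst)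
  then have "{G} \<tturnstile> Imp (Below r p1 p2) (Below r q1 q2)" "{G} \<tturnstile> Imp (Below r q1 q2) (Below r p1 p2)"
    using * eq_sym[OF *(1)] eq_sym[OF *(2)] Below
    by (meson mp prov Eq_Below wff.simps)+
  then show ?case by (simp add: d)
next
  case (And A B)
  then have IH: "{G} \<tturnstile> Imp (substF x \<rho> p A) (substF x \<rho> q A)" "{G} \<tturnstile> Imp (substF x \<rho> q A) (substF x \<rho> p A)"
    "{G} \<tturnstile> Imp (substF x \<rho> p B) (substF x \<rho> q B)" "{G} \<tturnstile> Imp (substF x \<rho> q B) (substF x \<rho> p B)"
    by auto
  have "{G} \<tturnstile> Imp (And A B) (And A' B')" if "{G} \<tturnstile> Imp A A'" "{G} \<tturnstile> Imp B B'" for A A' B B'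
  proof (rule deduct)
    show w: "wff L [] (And A B)" using that[THEN ent_wff] by simp
    then have "insert (And A B) {G} \<tturnstile> And A B" by (simp add: hyp)
    then show "insert (And A B) {G} \<tturnstile> And A' B'"
      using that[THEN weaken, OF subset_insertI] by (meson andI andE1 andE2 mp)
  qed
  with IH show ?case by simp
next
  case (Or A B)
  then have IH: "{G} \<tturnstile> Imp (substF x \<rho> p A) (substF x \<rho> q A)" "{G} \<tturnstile> Imp (substF x \<rho> q A) (substF x \<rho> p A)"
    "{G} \<tturnstile> Imp (substF x \<rho> p B) (substF x \<rho> q B)" "{G} \<tturnstile> Imp (substF x \<rho> q B) (substF x \<rho> p B)"
    by auto
  have "{G} \<tturnstile> Imp (Or A B) (Or A' B')" if "{G} \<tturnstile> Imp A A'" "{G} \<tturnstile> Imp B B'" for A A' B B'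
  proof (rule deduct)
    have w: "wff L [] A" "wff L [] B" "wff L [] A'" "wff L [] B'" using that[THEN ent_wff] by auto
    then show "wff L [] (Or A B)" by simp
    show "insert (Or A B) {G} \<tturnstile> Or A' B'"
    proof (rule orE)
      show "insert (Or A B) {G} \<tturnstile> Or A B" using w by (simp add: hyp)
      show "insert A (insert (Or A B) {G}) \<tturnstile> Or A' B'"
        using weaken[OF that(1)] w by (intro orI1 mp[of _ A A']) (auto intro: hyp)
      show "insert B (insert (Or A B) {G}) \<tturnstile> Or A' B'"
        using weaken[OF that(2)] w by (intro orI2 mp[of _ B B']) (auto intro: hyp)
    qed
  qed
  with IH show ?case by simp
next
  case (Imp A B)
  then have IH: "{G} \<tturnstile> Imp (substF x \<rho> p A) (substF x \<rho> q A)" "{G} \<tturnstile> Imp (substF x \<rho> q A) (substF x \<rho> p A)"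
    "{G} \<tturnstile> Imp (substF x \<rho> p B) (substF x \<rho> q B)" "{G} \<tturnstile> Imp (substF x \<rho> q B) (substF x \<rho> p B)"
    by auto
  have "{G} \<tturnstile> Imp (Imp A B) (Imp A' B')" if "{G} \<tturnstile> Imp A' A" "{G} \<tturnstile> Imp B B'" for A A' B B'
  proof (intro deduct)
    have w: "wff L [] A" "wff L [] B" "wff L [] A'" "wff L [] B'" using that[THEN ent_wff] by auto
    then show "wff L [] (Imp A B)" "wff L [] A'" by auto
    let ?H = "insert A' (insert (Imp A B) {G})"
    have "?H \<tturnstile> Imp A' A" "?H \<tturnstile> Imp B B'" "?H \<tturnstile> Imp A B" "?H \<tturnstile> A'"
      using that w by (auto intro: weaken hyp)
    then show "?H \<tturnstile> B'" by (meson mp)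
  qed
  with IH show ?case by simp
qed auto

text \<open>The equation must follow from the quantifier-free \<open>G\<close> alone, but the
  context in which it is used need only derive \<open>G\<close>. Thus rewriting remains possible
  when \<open>\<Gamma>\<close> contains a quantified formula, such as the induction hypothesis of
  the loop rule.\<close>

lemma replace:
  assumes "{G} \<tturnstile> eq_ext \<rho> p q" "qf G" "typed L [] p \<rho>" "typed L [] q \<rho>" "qf P" "wff L [] P"
    and "\<Gamma> \<tturnstile> G"
  shows "\<Gamma> \<tturnstile> substF x \<rho> p P \<longleftrightarrow> \<Gamma> \<tturnstile> substF x \<rho> q P"
  using replace_iff[OF assms(1,2) ent_wff[OF assms(7)] assms(3-6), of x] cut[OF assms(7)]
  by (meson mp)

lemma replace_eq:
  assumes "L \<turnstile> eq_ext \<rho> p q" "typed L [] p \<rho>" "typed L [] q \<rho>" "qf P" "wff L [] P"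
  shows "\<Gamma> \<tturnstile> substF x \<rho> p P \<longleftrightarrow> \<Gamma> \<tturnstile> substF x \<rho> q P"
  by (rule replace[where G = "Imp Bot Bot"]) (simp_all add: assms prov deduct hyp)

section \<open>Evaluation of commands\<close>

lemma beta:
  assumes "typed L [\<rho>] a \<sigma>" "typed L [] p \<rho>" "c = inst 0 p a"
  shows "\<Gamma> \<tturnstile> eq_ext \<sigma> (Lam \<rho> a \<cdot> p) c"
  using assms by (auto intro: prov Beta)

text \<open>The first argument belongs to the outer abstraction, hence to index 1, and is contracted
  first. That equation lives at a function type and is brought down to T by applying it to
  \<open>q\<close>.\<close>

lemma beta2:
  assumes a: "typed L [\<tau>, \<rho>] a TyT" and p: "typed L [] p \<rho>" and q: "typed L [] q \<tau>"
    and c: "c = inst 0 q (inst 1 p a)"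
  shows "\<Gamma> \<tturnstile> Eq TyT (Lam \<rho> (Lam \<tau> a) \<cdot> p \<cdot> q) c"
proof -
  have a': "typed L [\<tau>] (inst 1 p a) TyT" using typed_inst[of L "[\<tau>]" \<rho> a TyT p] a p by simp
  have "\<Gamma> \<tturnstile> eq_ext (\<tau> \<rightarrow> TyT) (Lam \<rho> (Lam \<tau> a) \<cdot> p) (Lam \<tau> (inst 1 p a))"
    using a p by (intro beta typed.Lam) auto
  then have "\<Gamma> \<tturnstile> eq_ext TyT (Lam \<rho> (Lam \<tau> a) \<cdot> p \<cdot> q) (Lam \<tau> (inst 1 p a) \<cdot> q)"
    using a a' p q by (intro eq_app) (auto intro: typed.Lam typed.App)
  moreover have "\<Gamma> \<tturnstile> eq_ext TyT (Lam \<tau> (inst 1 p a) \<cdot> q) c"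
    using a' q c by (intro beta) auto
  ultimately show ?thesis by (auto intro: eq_trans)
qed

section \<open>Evaluation of each command, forward and backward\<close>

lemma fwd_Skip: "typed L [] p TyS \<Longrightarrow> L \<turnstile> eq_ext TyS (fwd Skip \<cdot> p) p"
  using beta[of TyS "Bd 0" TyS p p "{}"] by (simp add: typing ent_empty)

lemma bwd_Skip: "typed L [] p TyS \<Longrightarrow> typed L [] q TyT \<Longrightarrow> L \<turnstile> eq_ext TyT (bwd Skip \<cdot> p \<cdot> q) q"
  using beta2[of TyT TyS "Bd 0" p q q "{}"] by (simp add: typing ent_empty)

lemma fwd_Seq:
  assumes "wf_com L C1" "wf_com L C2" "typed L [] p TyS"
  shows "L \<turnstile> eq_ext TyS (fwd (Seq C1 C2) \<cdot> p) (fwd C2 \<cdot> (fwd C1 \<cdot> p))"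
  using beta[of TyS "fwd C2 \<cdot> (fwd C1 \<cdot> Bd 0)" TyS p _ "{}"] assms by (simp add: typing ent_empty)

lemma bwd_Seq:
  assumes "wf_com L C1" "wf_com L C2" "typed L [] p TyS" "typed L [] q TyT"
  shows "L \<turnstile> eq_ext TyT (bwd (Seq C1 C2) \<cdot> p \<cdot> q) (bwd C1 \<cdot> p \<cdot> (bwd C2 \<cdot> (fwd C1 \<cdot> p) \<cdot> q))"
  using beta2[of TyT TyS "bwd C1 \<cdot> Bd 1 \<cdot> (bwd C2 \<cdot> (fwd C1 \<cdot> Bd 1) \<cdot> Bd 0)" p q _ "{}"] assms
  by (simp add: typing ent_empty inst_typed)

lemma cond_True:
  "{Test e p} \<tturnstile> eq_ext \<rho> (Cond e \<rho> \<cdot> p \<cdot> a \<cdot> b) a"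
  if "e \<in> Exps L" "typed L [] p TyS" "typed L [] a \<rho>" "typed L [] b \<rho>"
  using that by (intro mp[OF prov[OF Cond_True]] hyp) simp_all

lemma cond_False:
  "{Neg (Test e p)} \<tturnstile> eq_ext \<rho> (Cond e \<rho> \<cdot> p \<cdot> a \<cdot> b) b"
  if "e \<in> Exps L" "typed L [] p TyS" "typed L [] a \<rho>" "typed L [] b \<rho>"
  using that by (intro mp[OF prov[OF Cond_False]] hyp) simp_all

lemma fwd_If:
  assumes "e \<in> Exps L" "wf_com L C1" "wf_com L C2" "typed L [] p TyS"
  shows "{Test e p} \<tturnstile> eq_ext TyS (fwd (If e C1 C2) \<cdot> p) (fwd C1 \<cdot> p)"
    and "{Neg (Test e p)} \<tturnstile> eq_ext TyS (fwd (If e C1 C2) \<cdot> p) (fwd C2 \<cdot> p)"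
proof -
  have *: "\<Gamma> \<tturnstile> eq_ext TyS (fwd (If e C1 C2) \<cdot> p) (Cond e TyS \<cdot> p \<cdot> (fwd C1 \<cdot> p) \<cdot> (fwd C2 \<cdot> p))" for \<Gamma>
    using beta[of TyS "Cond e TyS \<cdot> Bd 0 \<cdot> (fwd C1 \<cdot> Bd 0) \<cdot> (fwd C2 \<cdot> Bd 0)" TyS p _ \<Gamma>] assms
    by (simp add: typing)
  have t: "typed L [] (fwd C1 \<cdot> p) TyS" "typed L [] (fwd C2 \<cdot> p) TyS"
    using assms by (simp_all add: typing)
  show "{Test e p} \<tturnstile> eq_ext TyS (fwd (If e C1 C2) \<cdot> p) (fwd C1 \<cdot> p)"
    using eq_trans * cond_True[OF assms(1,4) t] unfolding eq_ext.simps by blast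
  show "{Neg (Test e p)} \<tturnstile> eq_ext TyS (fwd (If e C1 C2) \<cdot> p) (fwd C2 \<cdot> p)"
    using eq_trans * cond_False[OF assms(1,4) t] unfolding eq_ext.simps by blast
qed

lemma bwd_If:
  assumes "e \<in> Exps L" "wf_com L C1" "wf_com L C2" "typed L [] p TyS" "typed L [] q TyT"
  shows "{Test e p} \<tturnstile> eq_ext TyT (bwd (If e C1 C2) \<cdot> p \<cdot> q) (bwd C1 \<cdot> p \<cdot> q)"
    and "{Neg (Test e p)} \<tturnstile> eq_ext TyT (bwd (If e C1 C2) \<cdot> p \<cdot> q) (bwd C2 \<cdot> p \<cdot> q)"
proof -
  have *: "\<Gamma> \<tturnstile> eq_ext TyT (bwd (If e C1 C2) \<cdot> p \<cdot> q)
      (Cond e TyT \<cdot> p \<cdot> (bwd C1 \<cdot> p \<cdot> q) \<cdot> (bwd C2 \<cdot> p \<cdot> q))" for \<Gamma>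
    using beta2[of TyT TyS
        "Cond e TyT \<cdot> Bd 1 \<cdot> (bwd C1 \<cdot> Bd 1 \<cdot> Bd 0) \<cdot> (bwd C2 \<cdot> Bd 1 \<cdot> Bd 0)" p q _ \<Gamma>] assms
    by (simp add: typing inst_typed)
  have t: "typed L [] (bwd C1 \<cdot> p \<cdot> q) TyT" "typed L [] (bwd C2 \<cdot> p \<cdot> q) TyT"
    using assms by (simp_all add: typing)
  show "{Test e p} \<tturnstile> eq_ext TyT (bwd (If e C1 C2) \<cdot> p \<cdot> q) (bwd C1 \<cdot> p \<cdot> q)"
    using eq_trans * cond_True[OF assms(1,4) t] unfolding eq_ext.simps by blast
  show "{Neg (Test e p)} \<tturnstile> eq_ext TyT (bwd (If e C1 C2) \<cdot> p \<cdot> q) (bwd C2 \<cdot> p \<cdot> q)"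
    using eq_trans * cond_False[OF assms(1,4) t] unfolding eq_ext.simps by blast
qed

text \<open>The assumption \<open>desc\<close> discharges the guard of the recursor equation at
  \<open>p\<close>, which then unfolds to a conditional. The step function merely returns the
  recursive value and the exit function is the identity.\<close>

lemma fwd_While:
  assumes C: "r \<in> Rels L" "e \<in> Exps L" "wf_com L C" and p: "typed L [] p TyS"
    and desc: "L \<turnstile> Imp (Test e p) (Below r (fwd C \<cdot> p) p)"
  shows "{Test e p} \<tturnstile> eq_ext TyS (fwd (While r e C) \<cdot> p) (fwd (While r e C) \<cdot> (fwd C \<cdot> p))"
    and "{Neg (Test e p)} \<tturnstile> eq_ext TyS (fwd (While r e C) \<cdot> p) p"
proof -
  let ?u = "Lam TyS (Bd 0)" and ?F = "Lam TyS (Lam TyS (Bd 0))"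
  let ?X = "fwd (While r e C) \<cdot> (fwd C \<cdot> p)"
  have X: "typed L [] ?X TyS" using C p by (simp add: typing)
  have t: "typed L [] (?F \<cdot> p \<cdot> ?X) TyS" "typed L [] (?u \<cdot> p) TyS" using C p by (simp_all add: typing)
  have *: "\<Gamma> \<tturnstile> Eq TyS (fwd (While r e C) \<cdot> p) (Cond e TyS \<cdot> p \<cdot> (?F \<cdot> p \<cdot> ?X) \<cdot> (?u \<cdot> p))" for \<Gamma>
    using WhileRec_eq[OF C _ _ p, of ?u TyS ?F] desc by (auto simp: typing intro: mp prov)
  \<comment> \<open>Contracting the outer abstraction of \<open>?F\<close> leaves the identity,
    which is literally the term \<open>?u\<close>.\<close>
  have "\<Gamma> \<tturnstile> eq_ext (TyS \<rightarrow> TyS) (?F \<cdot> p) ?u" for \<Gamma>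
    using p by (intro beta) (auto simp: typing)
  then have "\<Gamma> \<tturnstile> eq_ext TyS (?F \<cdot> p \<cdot> ?X) (?u \<cdot> ?X)" for \<Gamma>
    using p X by (intro eq_app[where \<rho> = TyS]) (simp_all add: typed_simps)
  moreover have u: "\<Gamma> \<tturnstile> eq_ext TyS (?u \<cdot> w) w" if "typed L [] w TyS" for \<Gamma> w
    using that by (intro beta) (auto simp: typing)
  ultimately have F: "\<Gamma> \<tturnstile> Eq TyS (?F \<cdot> p \<cdot> ?X) ?X" for \<Gamma>
    using u[OF X] eq_trans unfolding eq_ext.simps by blast
  show "{Test e p} \<tturnstile> eq_ext TyS (fwd (While r e C) \<cdot> p) ?X"
    using eq_trans * cond_True[OF C(2) p t] F unfolding eq_ext.simps by blast
  show "{Neg (Test e p)} \<tturnstile> eq_ext TyS (fwd (While r e C) \<cdot> p) p"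
    using eq_trans * cond_False[OF C(2) p t] u[OF p] unfolding eq_ext.simps by blast
qed

text \<open>Here the recursor has result type \<open>TyT \<rightarrow> TyT\<close>, so its unfolding
  equates functions. Each such equation is applied to \<open>q\<close>, giving equations at base
  type that can be chained by transitivity.\<close>

lemma bwd_While:
  assumes C: "r \<in> Rels L" "e \<in> Exps L" "wf_com L C" and p: "typed L [] p TyS" and q: "typed L [] q TyT"
    and desc: "L \<turnstile> Imp (Test e p) (Below r (fwd C \<cdot> p) p)"
  shows "{Test e p} \<tturnstile> eq_ext TyT (bwd (While r e C) \<cdot> p \<cdot> q)
      (bwd C \<cdot> p \<cdot> (bwd (While r e C) \<cdot> (fwd C \<cdot> p) \<cdot> q))"
    and "{Neg (Test e p)} \<tturnstile> eq_ext TyT (bwd (While r e C) \<cdot> p \<cdot> q) q"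
proof -
  let ?u = "Lam TyS (Lam TyT (Bd 0))"
  let ?F = "Lam TyS (Lam (TyT \<rightarrow> TyT) (Lam TyT (bwd C \<cdot> Bd 2 \<cdot> (Bd 1 \<cdot> Bd 0))))"
  let ?X = "bwd (While r e C) \<cdot> (fwd C \<cdot> p)"
  let ?cond = "Cond e (TyT \<rightarrow> TyT) \<cdot> p \<cdot> (?F \<cdot> p \<cdot> ?X) \<cdot> (?u \<cdot> p)"
  \<comment> \<open>Index 2 in unary form, so that instantiation and context lookup can be
    computed.\<close>
  note [simp] = numeral_2_eq_2
  have X: "typed L [] ?X (TyT \<rightarrow> TyT)" using C p by (simp add: typing)
  have W: "typed L [] (bwd (While r e C) \<cdot> p) (TyT \<rightarrow> TyT)" using C p by (simp add: typing)
  have t: "typed L [] (?F \<cdot> p \<cdot> ?X) (TyT \<rightarrow> TyT)" "typed L [] (?u \<cdot> p) (TyT \<rightarrow> TyT)"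
    "typed L [] ?cond (TyT \<rightarrow> TyT)"
    using C p by (simp_all add: typing)
  have "L \<turnstile> eq_ext (TyT \<rightarrow> TyT) (bwd (While r e C) \<cdot> p) ?cond"
    using WhileRec_eq[OF C _ _ p, of ?u "TyT \<rightarrow> TyT" ?F] desc C
    by (simp add: typing del: eq_ext.simps) (blast intro: MP)
  then have *: "\<Gamma> \<tturnstile> Eq TyT (bwd (While r e C) \<cdot> p \<cdot> q) (?cond \<cdot> q)" for \<Gamma>
    using eq_app[OF prov W t(3) q] by simp
  \<comment> \<open>The step function after receiving its state argument; \<open>p\<close> is
    locally closed, so it passes under the two remaining binders without lifting.\<close>
  let ?G = "Lam (TyT \<rightarrow> TyT) (Lam TyT (bwd C \<cdot> p \<cdot> (Bd 1 \<cdot> Bd 0)))"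
  have G: "typed L [] ?G ((TyT \<rightarrow> TyT) \<rightarrow> TyT \<rightarrow> TyT)" "typed L [] (?F \<cdot> p) ((TyT \<rightarrow> TyT) \<rightarrow> TyT \<rightarrow> TyT)"
    using C p by (simp_all add: typing typed_closed)
  have "\<Gamma> \<tturnstile> eq_ext ((TyT \<rightarrow> TyT) \<rightarrow> TyT \<rightarrow> TyT) (?F \<cdot> p) ?G" for \<Gamma>
    using C p by (intro beta) (simp_all add: typing)
  then have "\<Gamma> \<tturnstile> eq_ext (TyT \<rightarrow> TyT) (?F \<cdot> p \<cdot> ?X) (?G \<cdot> ?X)" for \<Gamma>
    using G X eq_app by blast
  then have "\<Gamma> \<tturnstile> eq_ext TyT (?F \<cdot> p \<cdot> ?X \<cdot> q) (?G \<cdot> ?X \<cdot> q)" for \<Gamma>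
    using t(1) typed.App[OF G(1) X] q eq_app by blast
  moreover have "\<Gamma> \<tturnstile> Eq TyT (?G \<cdot> ?X \<cdot> q) (bwd C \<cdot> p \<cdot> (?X \<cdot> q))" for \<Gamma>
    using C p X q by (intro beta2) (simp_all add: typing typed_closed inst_typed)
  ultimately have F: "\<Gamma> \<tturnstile> Eq TyT (?F \<cdot> p \<cdot> ?X \<cdot> q) (bwd C \<cdot> p \<cdot> (?X \<cdot> q))" for \<Gamma>
    using eq_trans unfolding eq_ext.simps by blast
  have u: "\<Gamma> \<tturnstile> Eq TyT (?u \<cdot> p \<cdot> q) q" for \<Gamma>
    using p q by (intro beta2) (simp_all add: typing)
  have "{Test e p} \<tturnstile> eq_ext TyT (?cond \<cdot> q) (?F \<cdot> p \<cdot> ?X \<cdot> q)"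
    using eq_app[OF cond_True[OF C(2) p t(1,2)] t(3,1) q] .
  then show "{Test e p} \<tturnstile> eq_ext TyT (bwd (While r e C) \<cdot> p \<cdot> q) (bwd C \<cdot> p \<cdot> (?X \<cdot> q))"
    using eq_trans * F unfolding eq_ext.simps by blast
  have "{Neg (Test e p)} \<tturnstile> eq_ext TyT (?cond \<cdot> q) (?u \<cdot> p \<cdot> q)"
    using eq_app[OF cond_False[OF C(2) p t(1,2)] t(3,2) q] .
  then show "{Neg (Test e p)} \<tturnstile> eq_ext TyT (bwd (While r e C) \<cdot> p \<cdot> q) q"
    using eq_trans * u unfolding eq_ext.simps by blast
qed

section \<open>The rules\<close>

lemma instance_prov: "L \<turnstile> A \<Longrightarrow> typed L [] u \<tau> \<Longrightarrow> L \<turnstile> substF x \<tau> u A"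
  by (blast intro: instantiate generalize provable_wff)

lemma tripleI:
  assumes "wff L [] P" "wf_com L C"
    and "{substF t TyT (bwd C \<cdot> Free s TyS \<cdot> Free t TyT) P} \<tturnstile> substF s TyS (fwd C \<cdot> Free s TyS) Q"
  shows "L \<turnstile> triple s t P C Q"
  unfolding triple_def using assms
  by (intro generalize ent_empty[THEN iffD1] deduct wff_subst) (simp_all add: typing)

text \<open>The triple at the forward state \<open>u\<close> and backward state \<open>v\<close>.
  Since s is instantiated before t, the term \<open>u\<close> must not contain t, or the second
  substitution would alter it.\<close>

lemma tripleE:
  assumes tr: "L \<turnstile> triple s t P C Q"
    and w: "wff L [] P" "wff L [] Q" "wf_com L C"
    and u: "typed L [] u TyS" "(t, TyT) \<notin> fv u" and v: "typed L [] v TyT"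
    and P: "\<Gamma> \<tturnstile> substF t TyT (bwd C \<cdot> u \<cdot> v) (substF s TyS u P)"
  shows "\<Gamma> \<tturnstile> substF t TyT v (substF s TyS (fwd C \<cdot> u) Q)"
proof -
  let ?B = "Imp (substF t TyT (bwd C \<cdot> Free s TyS \<cdot> Free t TyT) P) (substF s TyS (fwd C \<cdot> Free s TyS) Q)"
  have B: "wff L [] ?B" using w by (simp add: wff_subst typing)
  have "L \<turnstile> substF s TyS u (all_var t TyT ?B)"
    using tr u B unfolding triple_def by (intro instantiate wff_all_var)
  then have "L \<turnstile> all_var t TyT (substF s TyS u ?B)" using u by (simp add: substF_all_var)
  then have "L \<turnstile> substF t TyT v (substF s TyS u ?B)" using B u v by (intro instantiate wff_subst)
  then have "L \<turnstile> Imp (substF t TyT (bwd C \<cdot> u \<cdot> v) (substF s TyS u P))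
      (substF t TyT v (substF s TyS (fwd C \<cdot> u) Q))"
    \<comment> \<open>Replacing s commutes past the inner substitution for t, and nested
      substitutions for the same variable merge into one.\<close>
    using u by (simp add: substF_substF[of t TyT s TyS] substF_same subst_fresh)
  with P show ?thesis by (blast intro: mp prov)
qed

lemma assertionD: "assertion L s t P \<Longrightarrow> wff L [] P \<and> qf P"
  by (simp add: assertion_def)

section \<open>Loop-free commands and consequence\<close>

lemma skip_rule:
  assumes P: "wff L [] P" "qf P"
  shows "L \<turnstile> triple s t P Skip P"
proof (rule tripleI)
  let ?s = "Free s TyS" and ?t = "Free t TyT"
  let ?\<Gamma> = "{substF t TyT (bwd Skip \<cdot> ?s \<cdot> ?t) P}"
  have "?\<Gamma> \<tturnstile> substF t TyT (bwd Skip \<cdot> ?s \<cdot> ?t) P"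
    using P by (intro hyp wff_subst) (simp_all add: typing)
  then have "?\<Gamma> \<tturnstile> substF t TyT ?t P"
    using replace_eq[OF bwd_Skip[of ?s ?t] _ _ P(2,1)] by (simp add: typing)
  then show "?\<Gamma> \<tturnstile> substF s TyS (fwd Skip \<cdot> ?s) P"
    using replace_eq[OF fwd_Skip[of ?s] _ _ P(2,1)] by (simp add: typing substF_self)
qed (simp_all add: P)

text \<open>The forward and backward parts of a primitive command are the constants
  \<open>CmdF c\<close> and \<open>CmdB g\<close>, so the triple is the axiom itself, closed over s
  and t.\<close>

lemma prim_rule:
  assumes "Imp (substF t TyT (CmdB g \<cdot> Free s TyS \<cdot> Free t TyT) P)
    (substF s TyS (CmdF c \<cdot> Free s TyS) Q) \<in> Ax L"
  shows "L \<turnstile> triple s t P (Prim c g) Q"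
  using assms wf unfolding triple_def wf_extn_def by (auto intro: generalize Univ)

lemma consequence_rule:
  assumes P: "L \<turnstile> Imp P' P" and C: "wf_com L C" and tr: "L \<turnstile> triple s t P C Q" and Q: "L \<turnstile> Imp Q Q'"
  shows "L \<turnstile> triple s t P' C Q'"
proof (rule tripleI[OF _ C])
  let ?s = "Free s TyS" and ?t = "Free t TyT"
  let ?q = "bwd C \<cdot> ?s \<cdot> ?t"
  have w: "wff L [] P" "wff L [] P'" "wff L [] Q" "wff L [] Q'"
    using P Q provable_wff by fastforce+
  then show "wff L [] P'" by simp
  have ty: "typed L [] ?q TyT" "typed L [] (fwd C \<cdot> ?s) TyS" using C by (simp_all add: typing)
  let ?\<Gamma> = "{substF t TyT ?q P'}"
  have "?\<Gamma> \<tturnstile> substF t TyT ?q P'"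
    using w ty by (intro hyp wff_subst) auto
  then have "?\<Gamma> \<tturnstile> substF t TyT ?q P"
    using instance_prov[OF P ty(1), of t] by (auto intro: mp prov)
  \<comment> \<open>The precondition implication was used with t replaced by the backward value; the
    postcondition implication is used next with s replaced by the forward value.\<close>
  then have "?\<Gamma> \<tturnstile> substF s TyS (fwd C \<cdot> ?s) Q"
    using tripleE[OF tr w(1,3) C, of ?s ?t] by (simp add: typing substF_self)
  then show "?\<Gamma> \<tturnstile> substF s TyS (fwd C \<cdot> ?s) Q'"
    using instance_prov[OF Q ty(2), of s] by (auto intro: mp prov)
qed

lemma seq_rule:
  assumes P: "wff L [] P" "qf P" and Q: "wff L [] Q" and R: "wff L [] R" "qf R"
    and C: "wf_com L C1" "wf_com L C2"
    and tr: "L \<turnstile> triple s t P C1 Q" "L \<turnstile> triple s t Q C2 R"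
  shows "L \<turnstile> triple s t P (Seq C1 C2) R"
proof (rule tripleI)
  let ?s = "Free s TyS" and ?t = "Free t TyT"
  let ?s' = "fwd C1 \<cdot> ?s"
  let ?t' = "bwd C2 \<cdot> ?s' \<cdot> ?t"
  let ?\<Gamma> = "{substF t TyT (bwd (Seq C1 C2) \<cdot> ?s \<cdot> ?t) P}"
  have s: "typed L [] ?s TyS" and t: "typed L [] ?t TyT" by (simp_all add: typing)
  have "?\<Gamma> \<tturnstile> substF t TyT (bwd (Seq C1 C2) \<cdot> ?s \<cdot> ?t) P"
    using P C by (intro hyp wff_subst) (simp_all add: typing)
  then have "?\<Gamma> \<tturnstile> substF t TyT (bwd C1 \<cdot> ?s \<cdot> ?t') P"
    using replace_eq[OF bwd_Seq[OF C s t] _ _ P(2,1), of ?\<Gamma> t] C by (simp add: typing)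
  \<comment> \<open>The first triple is taken at the states \<open>?s\<close> and
    \<open>?t'\<close>, where \<open>?t'\<close> is what \<open>C2\<close> sends back from
    \<open>?s'\<close>. This is exactly the precondition of the second triple at \<open>?s'\<close>
    and \<open>?t\<close>.\<close>
  then have "?\<Gamma> \<tturnstile> substF t TyT ?t' (substF s TyS ?s' Q)"
    using tripleE[OF tr(1) P(1) Q C(1) s, of ?t'] C by (simp add: typing substF_self)
  then have "?\<Gamma> \<tturnstile> substF t TyT ?t (substF s TyS (fwd C2 \<cdot> ?s') R)"
    using C by (intro tripleE[OF tr(2) Q R(1) C(2)]) (simp_all add: typing)
  then show "?\<Gamma> \<tturnstile> substF s TyS (fwd (Seq C1 C2) \<cdot> ?s) R"
    using replace_eq[OF fwd_Seq[OF C s] _ _ R(2,1), of ?\<Gamma> s] C by (simp add: typing substF_self)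
qed (simp_all add: P C)

text \<open>Decidability of \<open>\<phi>\<close> permits a case split inside the calculus. The test
  mentions only s, so the substitution for t leaves it alone, and each case selects one half of
  \<open>or_if\<close> and one branch of both evaluations.\<close>

lemma if_rule:
  assumes P: "wff L [] P" "qf P" and Q: "wff L [] Q" "qf Q" and R: "wff L [] R" "qf R"
    and C: "e \<in> Exps L" "wf_com L C1" "wf_com L C2"
    and tr1: "L \<turnstile> triple s t (And P (Test e (Free s TyS))) C1 R"
    and tr2: "L \<turnstile> triple s t (And Q (Neg (Test e (Free s TyS)))) C2 R"
  shows "L \<turnstile> triple s t (or_if s e P Q) (If e C1 C2) R"
proof (rule tripleI)
  let ?s = "Free s TyS" and ?t = "Free t TyT"
  let ?\<phi> = "Test e ?s" and ?If = "If e C1 C2"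
  let ?q = "bwd ?If \<cdot> ?s \<cdot> ?t"
  let ?\<Gamma> = "{substF t TyT ?q (or_if s e P Q)}"
  have s: "typed L [] ?s TyS" and t: "typed L [] ?t TyT" by (simp_all add: typing)
  have tyIf: "typed L [] ?q TyT" "typed L [] (fwd ?If \<cdot> ?s) TyS" using C by (simp_all add: typing)
  have ty: "typed L [] (bwd C1 \<cdot> ?s \<cdot> ?t) TyT" "typed L [] (fwd C1 \<cdot> ?s) TyS"
    "typed L [] (bwd C2 \<cdot> ?s \<cdot> ?t) TyT" "typed L [] (fwd C2 \<cdot> ?s) TyS"
    using C by (simp_all add: typing)
  have wIf: "wff L [] (or_if s e P Q)" using P Q C by (simp add: or_if_def typing)
  then have "\<Delta> \<tturnstile> substF t TyT ?q (or_if s e P Q)" if "?\<Gamma> \<subseteq> \<Delta>" for \<Delta>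
    using that tyIf by (intro hyp wff_subst) auto
  then have or_if: "\<Delta> \<tturnstile> Imp ?\<phi> (substF t TyT ?q P)" "\<Delta> \<tturnstile> Imp (Neg ?\<phi>) (substF t TyT ?q Q)"
    if "?\<Gamma> \<subseteq> \<Delta>" for \<Delta>
    using that unfolding or_if_def by (auto dest: andE1 andE2)
  have "?\<Gamma> \<tturnstile> Or ?\<phi> (Neg ?\<phi>)" using C s by (intro prov Dec_Test)
  then show "?\<Gamma> \<tturnstile> substF s TyS (fwd ?If \<cdot> ?s) R"
  proof (rule orE)
    let ?\<Delta> = "insert ?\<phi> ?\<Gamma>"
    have \<phi>: "?\<Delta> \<tturnstile> ?\<phi>" using C by (intro hyp) (simp_all add: typing)
    have "?\<Delta> \<tturnstile> substF t TyT ?q P" using or_if(1)[of ?\<Delta>] \<phi> by (auto intro: mp)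
    then have "?\<Delta> \<tturnstile> substF t TyT (bwd C1 \<cdot> ?s \<cdot> ?t) P"
      using replace[OF bwd_If(1)[OF C s t] _ tyIf(1) ty(1) P(2,1) \<phi>, of t] by simp
    then have "?\<Delta> \<tturnstile> substF t TyT (bwd C1 \<cdot> ?s \<cdot> ?t) (And P ?\<phi>)"
      using \<phi> by (simp add: andI)
    then have "?\<Delta> \<tturnstile> substF s TyS (fwd C1 \<cdot> ?s) R"
      using tripleE[OF tr1 _ R(1) C(2) s _ t] P C by (simp add: typing substF_self)
    then show "?\<Delta> \<tturnstile> substF s TyS (fwd ?If \<cdot> ?s) R"
      using replace[OF fwd_If(1)[OF C s] _ tyIf(2) ty(2) R(2,1) \<phi>, of s] by simp
  next
    let ?\<Delta> = "insert (Neg ?\<phi>) ?\<Gamma>"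
    have \<phi>: "?\<Delta> \<tturnstile> Neg ?\<phi>" using C by (intro hyp) (simp_all add: typing)
    have "?\<Delta> \<tturnstile> substF t TyT ?q Q" using or_if(2)[of ?\<Delta>] \<phi> by (auto intro: mp)
    then have "?\<Delta> \<tturnstile> substF t TyT (bwd C2 \<cdot> ?s \<cdot> ?t) Q"
      using replace[OF bwd_If(2)[OF C s t] _ tyIf(1) ty(3) Q(2,1) \<phi>, of t] by simp
    then have "?\<Delta> \<tturnstile> substF t TyT (bwd C2 \<cdot> ?s \<cdot> ?t) (And Q (Neg ?\<phi>))"
      using \<phi> by (simp add: andI)
    then have "?\<Delta> \<tturnstile> substF s TyS (fwd C2 \<cdot> ?s) R"
      using tripleE[OF tr2 _ R(1) C(3) s _ t] Q C by (simp add: typing substF_self)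
    then show "?\<Delta> \<tturnstile> substF s TyS (fwd ?If \<cdot> ?s) R"
      using replace[OF fwd_If(2)[OF C s] _ tyIf(2) ty(4) R(2,1) \<phi>, of s] by simp
  qed
qed (use P Q C in \<open>simp_all add: or_if_def typing\<close>)

section \<open>Wellfounded induction and the loop\<close>

lemma generalize_hyp:
  assumes "{H} \<tturnstile> A" "wff L [] H" "(x, \<tau>) \<notin> fvF H"
  shows "{H} \<tturnstile> all_var x \<tau> A"
proof -
  have "L \<turnstile> Imp H A" using assms deduct ent_empty by blast
  then have "L \<turnstile> Imp H (all_var x \<tau> A)" using assms(3) by (rule All_I)
  then show ?thesis using assms(2) by (blast intro: mp prov hyp)
qed

text \<open>\<open>WF_Ind\<close> accepts only a theorem, so the induction hypothesis is a formula
  of the calculus and the step must become a provable implication. The caller sees that formula as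
  \<open>H\<close>: all its term instances are available, and the bound on its free variables
  permits generalization over other variables.\<close>

lemma wf_induct:
  assumes r: "r \<in> Rels L" and A: "wff L [] A"
    and step: "\<And>H. wff L [] H \<Longrightarrow> fvF H \<subseteq> insert (s, TyS) (fvF A) \<Longrightarrow>
      (\<And>u. typed L [] u TyS \<Longrightarrow> {H} \<tturnstile> Imp (Below r u (Free s TyS)) (substF s TyS u A)) \<Longrightarrow> {H} \<tturnstile> A"
  shows "L \<turnstile> all_var s TyS A"
proof -
  \<comment> \<open>A fresh name for the predecessor; as y does not occur in \<open>A\<close>,
    renaming s to y and then instantiating y amounts to instantiating s directly.\<close>
  obtain y where y: "y \<noteq> s" "(y, TyS) \<notin> fvF A" using ex_fresh by blast
  let ?B = "Imp (Below r (Free y TyS) (Free s TyS)) (substF s TyS (Free y TyS) A)"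
  have B: "wff L [] ?B" using r A by (simp add: typing wff_subst)
  have "{all_var y TyS ?B} \<tturnstile> A"
  proof (rule step)
    show "wff L [] (all_var y TyS ?B)" using B by (rule wff_all_var)
    show "fvF (all_var y TyS ?B) \<subseteq> insert (s, TyS) (fvF A)"
      using fvF_substF[of s TyS "Free y TyS" A] by (auto simp: fvF_all_var)
    fix u assume u: "typed L [] u TyS"
    have "{all_var y TyS ?B} \<tturnstile> substF y TyS u ?B"
      using B u by (intro specialize hyp wff_all_var) simp_all
    then show "{all_var y TyS ?B} \<tturnstile> Imp (Below r u (Free s TyS)) (substF s TyS u A)"
      using y by (simp add: substF_rename)
  qed
  then have "L \<turnstile> Imp (all_var y TyS ?B) A"
    using B by (intro ent_empty[THEN iffD1] deduct wff_all_var)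
  then show ?thesis using r A y by (intro WF_Ind[OF r A y] generalize)
qed

lemma while_rule:
  assumes P: "wff L [] P" "qf P"
    and C: "r \<in> Rels L" "e \<in> Exps L" "wf_com L C"
    and tr: "L \<turnstile> triple s t (And P (Test e (Free s TyS))) C P"
    and desc: "L \<turnstile> Imp (Test e (Free s TyS)) (Below r (fwd C \<cdot> Free s TyS) (Free s TyS))"
  shows "L \<turnstile> triple s t P (While r e C) (And P (Neg (Test e (Free s TyS))))"
proof -
  let ?s = "Free s TyS" and ?t = "Free t TyT"
  let ?\<phi> = "Test e ?s" and ?W = "While r e C"
  let ?Q = "And P (Neg ?\<phi>)"
  let ?B = "Imp (substF t TyT (bwd ?W \<cdot> ?s \<cdot> ?t) P) (substF s TyS (fwd ?W \<cdot> ?s) ?Q)"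
  let ?s' = "fwd C \<cdot> ?s"
  let ?t' = "bwd ?W \<cdot> ?s' \<cdot> ?t"
  have s: "typed L [] ?s TyS" and t: "typed L [] ?t TyT" by (simp_all add: typing)
  have ty: "typed L [] ?s' TyS" "typed L [] ?t' TyT" "typed L [] (bwd C \<cdot> ?s \<cdot> ?t') TyT"
    "typed L [] (bwd ?W \<cdot> ?s \<cdot> ?t) TyT" "typed L [] (fwd ?W \<cdot> ?s) TyS" "typed L [] (fwd ?W \<cdot> ?s') TyS"
    \<comment> \<open>The loop parts are kept folded throughout, so that the evaluation lemmas match
      and the recursor is unfolded just once.\<close>
    using C typed_fwd[of L ?W "[]"] typed_bwd[of L ?W "[]"]
    by (auto simp: typing(1,9,10) typed_simps(3) simp del: fwd.simps bwd.simps)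
  have Q: "wff L [] ?Q" "qf ?Q" using P C by (simp_all add: typing)
  have A: "wff L [] ?\<phi>" "wff L [] ?B" "wff L [] (substF t TyT (bwd ?W \<cdot> ?s \<cdot> ?t) P)"
    using P Q C ty s by (auto intro!: wff_subst simp del: fwd.simps bwd.simps)
  show ?thesis unfolding triple_def
  proof (rule wf_induct[OF C(1) wff_all_var[OF A(2)]])
    fix H
    assume H: "wff L [] H" "fvF H \<subseteq> insert (s, TyS) (fvF (all_var t TyT ?B))"
      and IH: "\<And>u. typed L [] u TyS \<Longrightarrow> {H} \<tturnstile> Imp (Below r u ?s) (substF s TyS u (all_var t TyT ?B))"
    let ?\<Gamma> = "{substF t TyT (bwd ?W \<cdot> ?s \<cdot> ?t) P, H}"
    have "?\<Gamma> \<tturnstile> Or ?\<phi> (Neg ?\<phi>)" using C s by (intro prov Dec_Test)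
    then have "?\<Gamma> \<tturnstile> substF s TyS (fwd ?W \<cdot> ?s) ?Q"
    proof (rule orE)
      let ?\<Delta> = "insert ?\<phi> ?\<Gamma>"
      have \<phi>: "?\<Delta> \<tturnstile> ?\<phi>" using A by (intro hyp) simp_all
      have "?\<Delta> \<tturnstile> substF t TyT (bwd ?W \<cdot> ?s \<cdot> ?t) P" using A by (intro hyp) simp_all
      \<comment> \<open>One backward unfolding exposes the final application of the body's backward
        part, so the premise applies at the backward state \<open>?t'\<close>.\<close>
      then have "?\<Delta> \<tturnstile> substF t TyT (bwd C \<cdot> ?s \<cdot> ?t') P"
        using replace[OF bwd_While(1)[OF C s t desc] _ ty(4,3) P(2,1) \<phi>, of t] by simp
      then have "?\<Delta> \<tturnstile> substF t TyT (bwd C \<cdot> ?s \<cdot> ?t') (And P ?\<phi>)" using \<phi> by (simp add: andI)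
      then have P': "?\<Delta> \<tturnstile> substF t TyT ?t' (substF s TyS ?s' P)"
        using P A C by (intro tripleE[OF tr _ _ _ s _ ty(2)]) (simp_all only: substF_self, simp_all)
      \<comment> \<open>Descent makes \<open>?s'\<close> a predecessor of \<open>?s\<close>, so the
        induction hypothesis is available there for every t.\<close>
      have "?\<Delta> \<tturnstile> Below r ?s' ?s" using desc \<phi> by (blast intro: mp prov)
      then have "?\<Delta> \<tturnstile> substF s TyS ?s' (all_var t TyT ?B)"
        using weaken[OF IH[OF ty(1)], of ?\<Delta>] by (auto intro: mp)
      then have "?\<Delta> \<tturnstile> all_var t TyT (substF s TyS ?s' ?B)" by (simp add: substF_all_var)
      then have "?\<Delta> \<tturnstile> substF t TyT ?t (substF s TyS ?s' ?B)"
        using A(2) ty(1) t by (intro specialize wff_subst)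
      \<comment> \<open>At \<open>?s'\<close> with t unchanged, the antecedent of the induction
        hypothesis is precisely what the body has just established as \<open>P'\<close>.\<close>
      then have "?\<Delta> \<tturnstile> Imp (substF t TyT ?t' (substF s TyS ?s' P)) (substF s TyS (fwd ?W \<cdot> ?s') ?Q)"
        unfolding substF_self
        by (simp add: substF_substF[of t TyT s TyS] substF_same del: fwd.simps bwd.simps)
      with P' have "?\<Delta> \<tturnstile> substF s TyS (fwd ?W \<cdot> ?s') ?Q" by (blast intro: mp)
      then show "?\<Delta> \<tturnstile> substF s TyS (fwd ?W \<cdot> ?s) ?Q"
        using replace[OF fwd_While(1)[OF C s desc] _ ty(5,6) Q(2,1) \<phi>, of s] by simp
    next
      let ?\<Delta> = "insert (Neg ?\<phi>) ?\<Gamma>"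
      have \<phi>: "?\<Delta> \<tturnstile> Neg ?\<phi>" using A by (intro hyp) simp_all
      have "?\<Delta> \<tturnstile> substF t TyT (bwd ?W \<cdot> ?s \<cdot> ?t) P" using A by (intro hyp) simp_all
      \<comment> \<open>On exit both parts of the loop act as identities, and the failed test
        supplies the second conjunct.\<close>
      then have "?\<Delta> \<tturnstile> P"
        using replace[OF bwd_While(2)[OF C s t desc] _ ty(4) t P(2,1) \<phi>, of t] by (simp add: substF_self)
      then have "?\<Delta> \<tturnstile> substF s TyS ?s ?Q" unfolding substF_self using \<phi> by (rule andI)
      then show "?\<Delta> \<tturnstile> substF s TyS (fwd ?W \<cdot> ?s) ?Q"
        using replace[OF fwd_While(2)[OF C s desc] _ ty(5) s Q(2,1) \<phi>, of s] by simp
    qed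
    then have "{H} \<tturnstile> ?B" using A(3) by (rule deduct)
    \<comment> \<open>The induction formula already binds t, so by the bound on its variables
      \<open>H\<close> does not contain t and the result can be generalized over t.\<close>
    moreover have "(t, TyT) \<notin> fvF H" using H(2) by (auto simp: fvF_all_var)
    ultimately show "{H} \<tturnstile> all_var t TyT ?B" using H(1) generalize_hyp by blast
  qed
qed

end

theorem theorem7:
  fixes L :: "('c, 'g, 'e, 'r) extn" and s t :: nat
  assumes "wf_extn L"
  shows
    "(\<forall>P. assertion L s t P \<longrightarrow> L \<turnstile> triple s t P Skip P)
   \<and> (\<forall>P Q c g. assertion L s t P \<longrightarrow> assertion L s t Q \<longrightarrow> c \<in> CommF L \<longrightarrow> g \<in> CommB L \<longrightarrow>
        Imp (substF t TyT (CmdB g \<cdot> Free s TyS \<cdot> Free t TyT) P)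
            (substF s TyS (CmdF c \<cdot> Free s TyS) Q) \<in> Ax L \<longrightarrow>
        L \<turnstile> triple s t P (Prim c g) Q)
   \<and> (\<forall>P P' Q Q' C. assertion L s t P \<longrightarrow> assertion L s t P' \<longrightarrow>
        assertion L s t Q \<longrightarrow> assertion L s t Q' \<longrightarrow> wf_com L C \<longrightarrow>
        L \<turnstile> Imp P' P \<longrightarrow> L \<turnstile> triple s t P C Q \<longrightarrow> L \<turnstile> Imp Q Q' \<longrightarrow>
        L \<turnstile> triple s t P' C Q')
   \<and> (\<forall>P Q R C1 C2. assertion L s t P \<longrightarrow> assertion L s t Q \<longrightarrow> assertion L s t R \<longrightarrow>
        wf_com L C1 \<longrightarrow> wf_com L C2 \<longrightarrow>
        L \<turnstile> triple s t P C1 Q \<longrightarrow> L \<turnstile> triple s t Q C2 R \<longrightarrow>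
        L \<turnstile> triple s t P (Seq C1 C2) R)
   \<and> (\<forall>P Q R e C1 C2. assertion L s t P \<longrightarrow> assertion L s t Q \<longrightarrow> assertion L s t R \<longrightarrow>
        e \<in> Exps L \<longrightarrow> wf_com L C1 \<longrightarrow> wf_com L C2 \<longrightarrow>
        L \<turnstile> triple s t (And P (Test e (Free s TyS))) C1 R \<longrightarrow>
        L \<turnstile> triple s t (And Q (Neg (Test e (Free s TyS)))) C2 R \<longrightarrow>
        L \<turnstile> triple s t (or_if s e P Q) (If e C1 C2) R)
   \<and> (\<forall>P e r C. assertion L s t P \<longrightarrow> e \<in> Exps L \<longrightarrow> r \<in> Rels L \<longrightarrow> wf_com L C \<longrightarrow>
        L \<turnstile> triple s t (And P (Test e (Free s TyS))) C P \<longrightarrow>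
        L \<turnstile> Imp (Test e (Free s TyS)) (Below r (fwd C \<cdot> Free s TyS) (Free s TyS)) \<longrightarrow>
        L \<turnstile> triple s t P (While r e C) (And P (Neg (Test e (Free s TyS)))))"
proof -
  interpret extension L using assms by unfold_locales
  show ?thesis
  proof (intro conjI allI impI, goal_cases)
    case (1 P)
    then show ?case by (simp add: skip_rule assertionD)
  next
    case (2 P Q c g)
    then show ?case by (simp add: prim_rule)
  next
    case (3 P P' Q Q' C)
    then show ?case using consequence_rule[of P' P C s t Q Q'] by simp
  next
    case (4 P Q R C1 C2)
    then show ?case using seq_rule[of P Q R C1 C2 s t] by (simp add: assertionD)
  next
    case (5 P Q R e C1 C2)
    then show ?case using if_rule[of P Q R e C1 C2 s t] by (simp add: assertionD)
  next
    case (6 P e r C)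
    then show ?case using while_rule[of P r e C s t] by (simp add: assertionD)
  qed
qed

end
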